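(* For every $n\ge1$, $$\overline{A}_n(x,y)=\sum_{i=0}^{\lfloor n/2\rfloor}(-1)^i\,\bar d(n,i)\,(x+y)^i(1+x+y+xy)^{\lfloor n/2\rfloor-i},$$ and $rs_{n-1}(1+x)=\sum_{i=0}^{\lfloor n/2\rfloor}\bar d(n,i)x^i$.
   Context: For $\sigma\in\mathfrak{S}_n$, a position $i\in[n-1]$ is a descent if $\sigma(i)>\sigma(i+1)$ and an ascent if $\sigma(i)<\sigma(i+1)$; $\mathrm{des}_1\sigma$ is the number of descents at odd positions, $\mathrm{asc}_0\sigma$ the number of ascents at even positions. $\widehat{A}_n(x,y)=\sum_{\sigma\in\mathfrak{S}_n}x^{\mathrm{des}_1\sigma}y^{\mathrm{asc}_0\sigma}$, and $\overline{A}_{2m}(x,y)=(1+y)\widehat{A}_{2m}(x,y)$, $\overline{A}_{2m-1}(x,y)=\widehat{A}_{2m-1}(x,y)$. The $\pi(i)$-factorization of $\pi=\pi(1)\cdots\pi(n)$ is $(w_1,w_2,\pi(i),w_4,w_5)$ with $w_1w_2\pi(i)w_4w_5=\pi$, $w_2$ the longest right factor of $\pi(1)\cdots\pi(i-1)$ with all letters $>\pi(i)$, and $w_4$ the longest left factor of $\pi(i+1)\cdots\pi(n)$ with all letters $>\pi(i)$. An André permutation is $\pi\in\mathfrak{S}_n$ with no double descents, $\pi(n-1)<\pi(n)$, and such that for every valley $i$ ($2\le i\le n-1$, $\pi(i-1)>\pi(i)<\pi(i+1)$) the maximum letter of $w_2$ is smaller than the maximum letter of $w_4$ in its $\pi(i)$-factorization.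 $d(n,j)$ is the number of André permutations of length $n$ with $j$ descents, and $\bar d(n,i)=\sum_{j=i}^{\lfloor n/2\rfloor}\binom{j}{i}d(n,j)$. A permutation $w$ of $[m]$ is a Simsun permutation if for every $k=1,\dots,m$ the subsequence of $w$ formed by its $k$ smallest letters has no three consecutive entries in decreasing order; $rs_m(x)=\sum_w x^{\mathrm{des}\,w}$ over Simsun permutations of $[m]$ ($rs_0=1$). *)

theory Defs
  imports Complex_Main "HOL-Combinatorics.Multiset_Permutations" "HOL-Library.Sublist"
begin

text \<open>
  A permutation of \<open>[n]\<close> is represented by its one-line word, an element of
  \<^term>\<open>permutations_of_set {1..n}\<close>. Positions are counted from 1.
\<close>

definition letter :: "nat list \<Rightarrow> nat \<Rightarrow> nat" where
  "letter w i = w ! (i - 1)"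

definition descents :: "nat list \<Rightarrow> nat set" where
  "descents w = {i. 1 \<le> i \<and> i < length w \<and> letter w i > letter w (i + 1)}"

definition ascents :: "nat list \<Rightarrow> nat set" where
  "ascents w = {i. 1 \<le> i \<and> i < length w \<and> letter w i < letter w (i + 1)}"

definition des :: "nat list \<Rightarrow> nat" where
  "des w = card (descents w)"

definition des1 :: "nat list \<Rightarrow> nat" where
  "des1 w = card {i \<in> descents w. odd i}"

definition asc0 :: "nat list \<Rightarrow> nat" where
  "asc0 w = card {i \<in> ascents w. even i}"

text \<open>
  Polynomials are given by their values at arbitrary elements of an arbitrary commutative ring.
  Taking the two indeterminates over the integers as arguments yields the formal polynomials,
  so identities for all commutative rings are exactly the formal polynomial identities.
\<close>

definition A_hat :: "nat \<Rightarrow> 'a::comm_ring_1 \<Rightarrow> 'a \<Rightarrow> 'a" where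
  "A_hat n x y = (\<Sum>w\<in>permutations_of_set {1..n}. x ^ des1 w * y ^ asc0 w)"

definition A_bar :: "nat \<Rightarrow> 'a::comm_ring_1 \<Rightarrow> 'a \<Rightarrow> 'a" where
  "A_bar n x y = (if even n then (1 + y) * A_hat n x y else A_hat n x y)"

definition double_descent :: "nat list \<Rightarrow> nat \<Rightarrow> bool" where
  "double_descent w i \<longleftrightarrow> 2 \<le> i \<and> i < length w \<and>
     letter w (i - 1) > letter w i \<and> letter w i > letter w (i + 1)"

definition valley :: "nat list \<Rightarrow> nat \<Rightarrow> bool" where
  "valley w i \<longleftrightarrow> 2 \<le> i \<and> i < length w \<and>
     letter w (i - 1) > letter w i \<and> letter w i < letter w (i + 1)"

definition letter_factorization ::
    "nat list \<Rightarrow> nat \<Rightarrow> nat list \<times> nat list \<times> nat \<times> nat list \<times> nat list \<Rightarrow> bool" where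
  "letter_factorization w i = (\<lambda>(w1, w2, a, w4, w5).
     a = letter w i \<and>
     w1 @ w2 = take (i - 1) w \<and> w4 @ w5 = drop i w \<and>
     (\<forall>b\<in>set w2. b > a) \<and>
     (\<forall>v. suffix v (take (i - 1) w) \<and> (\<forall>b\<in>set v. b > a) \<longrightarrow> length v \<le> length w2) \<and>
     (\<forall>b\<in>set w4. b > a) \<and>
     (\<forall>v. prefix v (drop i w) \<and> (\<forall>b\<in>set v. b > a) \<longrightarrow> length v \<le> length w4))"

lemma letter_factorization_append:
  assumes "letter_factorization w i (w1, w2, a, w4, w5)" "1 \<le> i" "i \<le> length w"
  shows "w1 @ w2 @ [a] @ w4 @ w5 = w"
proof -
  have "w = take (i - 1) w @ w ! (i - 1) # drop (Suc (i - 1)) w"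
    using assms(2,3) by (intro id_take_nth_drop) simp
  moreover have "w1 @ w2 = take (i - 1) w" "w4 @ w5 = drop i w" "a = w ! (i - 1)"
    using assms(1) by (auto simp: letter_factorization_def letter_def)
  ultimately show ?thesis
    using assms(2) by (simp flip: append_assoc)
qed

lemma letter_factorization_exists:
  "\<exists>w1 w2 w4 w5. letter_factorization w i (w1, w2, letter w i, w4, w5)"
proof -
  define P where "P = (\<lambda>b. b > letter w i)"
  have pre: "length v \<le> length (takeWhile P u)" if "prefix v u" "\<forall>b\<in>set v. P b" for v u
    using that by (auto simp: prefix_def takeWhile_append)
  define u where "u = rev (take (i - 1) w)"
  have "rev (dropWhile P u) @ rev (takeWhile P u) = take (i - 1) w"
    by (simp add: u_def flip: rev_append)
  moreover have "length v \<le> length (rev (takeWhile P u))"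
    if "suffix v (take (i - 1) w)" "\<forall>b\<in>set v. P b" for v
    using pre[of "rev v" u] that by (simp add: suffix_to_prefix u_def)
  ultimately have "letter_factorization w i
      (rev (dropWhile P u), rev (takeWhile P u), letter w i,
       takeWhile P (drop i w), dropWhile P (drop i w))"
    using pre[of _ "drop i w"] set_takeWhileD[of _ P]
    unfolding letter_factorization_def P_def by auto
  then show ?thesis
    by blast
qed

text \<open>For \<open>n \<le> 1\<close> there is no last pair of letters, and the condition on it is void.\<close>

definition andre_permutations :: "nat \<Rightarrow> nat list set" where
  "andre_permutations n = {w \<in> permutations_of_set {1..n}.
     (\<forall>i. \<not> double_descent w i) \<and>
     (n \<ge> 2 \<longrightarrow> letter w (n - 1) < letter w n) \<and>
     (\<forall>i. valley w i \<longrightarrow>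
        (\<forall>w1 w2 a w4 w5. letter_factorization w i (w1, w2, a, w4, w5) \<longrightarrow>
           Max (set w2) < Max (set w4)))}"

definition d :: "nat \<Rightarrow> nat \<Rightarrow> nat" where
  "d n j = card {w \<in> andre_permutations n. des w = j}"

definition d_bar :: "nat \<Rightarrow> nat \<Rightarrow> nat" where
  "d_bar n i = (\<Sum>j = i..n div 2. (j choose i) * d n j)"

text \<open>In a permutation of \<open>[m]\<close> the \<open>k\<close> smallest letters are those that are at most \<open>k\<close>.\<close>

definition simsun_permutations :: "nat \<Rightarrow> nat list set" where
  "simsun_permutations m = {w \<in> permutations_of_set {1..m}.
     \<forall>k\<in>{1..m}. \<forall>i. \<not> double_descent (filter (\<lambda>a. a \<le> k) w) i}"

definition rs :: "nat \<Rightarrow> 'a::comm_ring_1 \<Rightarrow> 'a" where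
  "rs m x = (\<Sum>w\<in>simsun_permutations m. x ^ des w)"

end

theory Submission
  imports Defs "HOL-Computational_Algebra.Polynomial"
begin

text \<open>
  Every permutation factors uniquely as \<open>u m v\<close> around its minimal letter \<open>m\<close>, and all three
  families are enumerated through this factorization. Put \<open>P = (1 + x) (1 + y)\<close> and
  \<open>Q = 1 + x y\<close>.

  In an Andre permutation with \<open>u\<close> nonempty the maximal letter lies in \<open>v\<close>, and \<open>u\<close>, \<open>v\<close> are
  Andre again; this is a quadratic recurrence for the Andre polynomials. Call \<open>w\<close> an ended Simsun
  word if \<open>w 0\<close> is Simsun. In an ended Simsun word with \<open>u\<close> nonempty the second smallest letter
  lies in \<open>v\<close>, and \<open>u\<close>, \<open>v\<close> are ended Simsun words, which is the same recurrence; finally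
  \<open>u m v\<close> is Simsun iff \<open>u\<close> is ended Simsun and \<open>v\<close> is Simsun, and this gives the Andre
  polynomial of the next index.

  Factoring around the minimal and, by complementation, around the maximal letter gives two
  recurrences for \<open>A_hat\<close>. Their sum is twice the recurrence of the Andre polynomials homogenized
  by \<open>P\<close> and \<open>Q\<close>. The factor 2 is cancelled in the polynomial ring over the integers, from which
  the identity is transported to an arbitrary commutative ring. The expansion in \<open>d_bar\<close> is then
  the binomial theorem for \<open>Q = P - (x + y)\<close>.
\<close>

section \<open>Splitting permutations around a letter\<close>

text \<open>A word is recovered from the set \<open>T\<close> of letters before \<open>m\<close> and
  the arrangements on both sides of \<open>m\<close>; the inverse map cuts at the first, hence only,
  occurrence of \<open>m\<close>.\<close>

lemma sum_permutations_of_set_split: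
  assumes "finite S" "m \<in> S"
  shows "(\<Sum>w\<in>permutations_of_set S. \<phi> w) =
    (\<Sum>T\<in>Pow (S - {m}). \<Sum>u\<in>permutations_of_set T. \<Sum>v\<in>permutations_of_set (S - {m} - T).
       \<phi> (u @ m # v))"
proof -
  define D where "D = (SIGMA T:Pow (S - {m}). permutations_of_set T \<times> permutations_of_set (S - {m} - T))"
  have "(\<Sum>w\<in>permutations_of_set S. \<phi> w) = (\<Sum>(T, u, v)\<in>D. \<phi> (u @ m # v))"
  proof (rule sum.reindex_bij_witness[where
        i = "\<lambda>(T, u, v). u @ m # v" and
        j = "\<lambda>w. (set (takeWhile (\<lambda>a. a \<noteq> m) w), takeWhile (\<lambda>a. a \<noteq> m) w,
                    tl (dropWhile (\<lambda>a. a \<noteq> m) w))"])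
    fix w assume w: "w \<in> permutations_of_set S"
    then obtain u v where uv: "w = u @ m # v" "m \<notin> set u"
      using assms(2) by (metis permutations_of_setD(1) split_list_first)
    have "distinct w" "set w = S"
      using w by (auto simp: permutations_of_setD)
    then show "(\<lambda>(T, u, v). u @ m # v) (set (takeWhile (\<lambda>a. a \<noteq> m) w), takeWhile (\<lambda>a. a \<noteq> m) w,
                    tl (dropWhile (\<lambda>a. a \<noteq> m) w)) = w"
      and "(set (takeWhile (\<lambda>a. a \<noteq> m) w), takeWhile (\<lambda>a. a \<noteq> m) w,
                    tl (dropWhile (\<lambda>a. a \<noteq> m) w)) \<in> D"
      and "(\<lambda>(T, u, v). \<phi> (u @ m # v)) (set (takeWhile (\<lambda>a. a \<noteq> m) w),
             takeWhile (\<lambda>a. a \<noteq> m) w, tl (dropWhile (\<lambda>a. a \<noteq> m) w)) = \<phi> w"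
      using uv by (auto simp: D_def permutations_of_set_def takeWhile_append dropWhile_append)
  next
    fix z assume "z \<in> D"
    then obtain T u v where "z = (T, u, v)" "T \<subseteq> S - {m}"
      "u \<in> permutations_of_set T" "v \<in> permutations_of_set (S - {m} - T)"
      by (auto simp: D_def)
    moreover from this have "m \<notin> set u"
      by (auto simp: permutations_of_set_def)
    ultimately show "(set (takeWhile (\<lambda>a. a \<noteq> m) ((\<lambda>(T, u, v). u @ m # v) z)),
          takeWhile (\<lambda>a. a \<noteq> m) ((\<lambda>(T, u, v). u @ m # v) z),
          tl (dropWhile (\<lambda>a. a \<noteq> m) ((\<lambda>(T, u, v). u @ m # v) z))) = z"
      and "(\<lambda>(T, u, v). u @ m # v) z \<in> permutations_of_set S"
      using assms(2)
      by (auto simp: permutations_of_set_def takeWhile_append dropWhile_append)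
  qed
  also have "\<dots> = (\<Sum>T\<in>Pow (S - {m}). \<Sum>u\<in>permutations_of_set T. \<Sum>v\<in>permutations_of_set (S - {m} - T).
       \<phi> (u @ m # v))"
    unfolding D_def using assms(1)
    by (simp add: sum.Sigma sum.cartesian_product)
  finally show ?thesis .
qed

lemma sum_Pow_card:
  fixes g :: "nat \<Rightarrow> 'a::comm_semiring_1"
  assumes "finite X"
  shows "(\<Sum>T\<in>Pow X. g (card T)) = (\<Sum>k\<le>card X. of_nat (card X choose k) * g k)"
proof -
  have "(\<Sum>T\<in>Pow X. g (card T)) = (\<Sum>k\<le>card X. \<Sum>T\<in>{T \<in> Pow X. card T = k}. g (card T))"
    using assms by (intro sum.group[symmetric]) (auto intro: card_mono)
  also have "\<dots> = (\<Sum>k\<le>card X. of_nat (card X choose k) * g k)"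
    using assms by (intro sum.cong) (auto simp: n_subsets)
  finally show ?thesis .
qed

text \<open>When the weight factors across \<open>m\<close> and the block sums depend only on
  cardinalities, the sum over left letter sets collapses to a binomial sum. The index of
  \<open>\<beta>\<close> records the left length, since the parity of the starting position of
  \<open>v\<close> may matter.\<close>

lemma sum_permutations_of_set_rec:
  fixes \<phi> \<alpha> :: "nat list \<Rightarrow> 'a::comm_semiring_1" and \<beta> :: "nat \<Rightarrow> nat list \<Rightarrow> 'a"
  assumes S: "finite S" "card S = Suc n" "m \<in> S"
    and \<phi>: "\<And>u v. u @ m # v \<in> permutations_of_set S \<Longrightarrow>
               \<phi> (u @ m # v) = c (length u) * \<alpha> u * \<beta> (length u) v"
    and \<alpha>: "\<And>T. T \<subseteq> S - {m} \<Longrightarrow> (\<Sum>u\<in>permutations_of_set T. \<alpha> u) = A (card T)"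
    and \<beta>: "\<And>T k. T \<subseteq> S - {m} \<Longrightarrow> card T + k = n \<Longrightarrow>
               (\<Sum>v\<in>permutations_of_set T. \<beta> k v) = B k"
  shows "(\<Sum>w\<in>permutations_of_set S. \<phi> w) = (\<Sum>k\<le>n. of_nat (n choose k) * (c k * A k * B k))"
proof -
  have card: "card (S - {m}) = n" and fin: "finite (S - {m})"
    using S by auto
  have "(\<Sum>u\<in>permutations_of_set T. \<Sum>v\<in>permutations_of_set (S - {m} - T). \<phi> (u @ m # v)) =
      c (card T) * A (card T) * B (card T)" if T: "T \<in> Pow (S - {m})" for T
  proof -
    have finT: "finite T"
      using T fin finite_subset by blast
    have "card (S - {m} - T) + card T = n"
      using T fin finT card card_Diff_subset[of T "S - {m}"] card_mono[of "S - {m}" T] by simp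
    then have B: "(\<Sum>v\<in>permutations_of_set (S - {m} - T). \<beta> (card T) v) = B (card T)"
      by (intro \<beta>) auto
    have "(\<Sum>u\<in>permutations_of_set T. \<Sum>v\<in>permutations_of_set (S - {m} - T). \<phi> (u @ m # v)) =
       (\<Sum>u\<in>permutations_of_set T. \<Sum>v\<in>permutations_of_set (S - {m} - T).
          c (card T) * (\<alpha> u * \<beta> (card T) v))"
    proof (intro sum.cong refl)
      fix u v assume u: "u \<in> permutations_of_set T" and v: "v \<in> permutations_of_set (S - {m} - T)"
      have "length u = card T"
        using u finT by (simp add: length_finite_permutations_of_set)
      moreover have "u @ m # v \<in> permutations_of_set S"
        using u v T S(3) by (auto simp: permutations_of_set_def)
      ultimately show "\<phi> (u @ m # v) = c (card T) * (\<alpha> u * \<beta> (card T) v)"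
        using \<phi> by (simp add: mult.assoc)
    qed
    also have "\<dots> = c (card T) * ((\<Sum>u\<in>permutations_of_set T. \<alpha> u) *
        (\<Sum>v\<in>permutations_of_set (S - {m} - T). \<beta> (card T) v))"
      unfolding sum_product by (simp add: sum_distrib_left)
    also have "\<dots> = c (card T) * (A (card T) * B (card T))"
      using \<alpha>[of T] B T by simp
    finally show ?thesis
      by (simp add: mult.assoc)
  qed
  then have "(\<Sum>w\<in>permutations_of_set S. \<phi> w) =
      (\<Sum>T\<in>Pow (S - {m}). c (card T) * A (card T) * B (card T))"
    using S by (simp add: sum_permutations_of_set_split)
  also have "\<dots> = (\<Sum>k\<le>n. of_nat (n choose k) * (c k * A k * B k))"
    using sum_Pow_card[OF fin, of "\<lambda>k. c k * A k * B k"] card by simp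
  finally show ?thesis .
qed

text \<open>Variant for weights that vanish when \<open>z\<close> precedes \<open>m\<close>: with
  both letters placed, only \<open>n\<close> are left to distribute, whence
  \<open>n choose k\<close>. The empty left block is kept apart because it has its own coefficient
  \<open>c0\<close>.\<close>

lemma sum_permutations_of_set_rec2:
  fixes \<phi> :: "nat list \<Rightarrow> 'a::comm_semiring_1"
  assumes S: "finite S" "card S = Suc (Suc n)" "m \<in> S" "z \<in> S" "z \<noteq> m"
    and zero: "\<And>u v. u @ m # v \<in> permutations_of_set S \<Longrightarrow> z \<in> set u \<Longrightarrow> \<phi> (u @ m # v) = 0"
    and first: "\<And>v. m # v \<in> permutations_of_set S \<Longrightarrow> \<phi> (m # v) = c0 * \<phi> v"
    and \<phi>: "\<And>u v. u @ m # v \<in> permutations_of_set S \<Longrightarrow> u \<noteq> [] \<Longrightarrow> z \<in> set v \<Longrightarrow>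
               \<phi> (u @ m # v) = c (length u) * (\<phi> u * \<phi> v)"
    and IH: "\<And>T. T \<subseteq> S - {m} \<Longrightarrow> T \<noteq> {} \<Longrightarrow> (\<Sum>u\<in>permutations_of_set T. \<phi> u) = A (card T)"
  shows "(\<Sum>w\<in>permutations_of_set S. \<phi> w) =
    c0 * A (Suc n) + (\<Sum>k = 1..n. of_nat (n choose k) * (c k * (A k * A (Suc n - k))))"
proof -
  define g where "g k = (if k = 0 then c0 * A (Suc n) else c k * (A k * A (Suc n - k)))" for k
  define X where "X = S - {m} - {z}"
  have card: "card X = n" and fin: "finite X" and sub: "X \<subseteq> S - {m}"
    using S by (auto simp: X_def)
  let ?in = "\<lambda>T. \<Sum>u\<in>permutations_of_set T. \<Sum>v\<in>permutations_of_set (S - {m} - T). \<phi> (u @ m # v)"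
  have "(\<Sum>w\<in>permutations_of_set S. \<phi> w) = (\<Sum>T\<in>Pow (S - {m}). ?in T)"
    using S by (simp add: sum_permutations_of_set_split)
  \<comment> \<open>A left block containing \<open>z\<close> contributes nothing by
    \<open>zero\<close>.\<close>
  also have "\<dots> = (\<Sum>T\<in>Pow X. ?in T)"
  proof (rule sum.mono_neutral_right)
    show "\<forall>T\<in>Pow (S - {m}) - Pow X. ?in T = 0"
    proof (intro ballI sum.neutral)
      fix T u v assume *: "T \<in> Pow (S - {m}) - Pow X" "u \<in> permutations_of_set T"
         "v \<in> permutations_of_set (S - {m} - T)"
      then have "u @ m # v \<in> permutations_of_set S" "z \<in> set u"
        using S(3) by (auto simp: permutations_of_set_def X_def)
      then show "\<phi> (u @ m # v) = 0"
        by (rule zero)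
    qed
  qed (use S in \<open>auto simp: X_def\<close>)
  also have "\<dots> = (\<Sum>T\<in>Pow X. g (card T))"
  proof (intro sum.cong refl)
    fix T assume T: "T \<in> Pow X"
    then have finT: "finite T"
      using fin finite_subset by blast
    have perm: "u @ m # v \<in> permutations_of_set S"
      if "u \<in> permutations_of_set T" "v \<in> permutations_of_set (S - {m} - T)" for u v
      using that T S(3) by (auto simp: permutations_of_set_def X_def)
    have "card (S - {m} - T) = Suc n - card T"
      using T sub S(2,3) finT by (subst card_Diff_subset) auto
    moreover have "z \<in> S - {m} - T"
      using T S by (auto simp: X_def)
    ultimately have V: "(\<Sum>v\<in>permutations_of_set (S - {m} - T). \<phi> v) = A (Suc n - card T)"
      using IH[of "S - {m} - T"] by auto
    show "?in T = g (card T)"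
    proof (cases "T = {}")
      case True
      then have "?in T = (\<Sum>v\<in>permutations_of_set (S - {m}). c0 * \<phi> v)"
        using first perm by (auto intro!: sum.cong)
      then show ?thesis
        using V True by (simp add: g_def flip: sum_distrib_left)
    next
      case False
      have "?in T = (\<Sum>u\<in>permutations_of_set T. \<Sum>v\<in>permutations_of_set (S - {m} - T).
          c (card T) * (\<phi> u * \<phi> v))"
      proof (intro sum.cong refl)
        fix u v assume uv: "u \<in> permutations_of_set T" "v \<in> permutations_of_set (S - {m} - T)"
        then have "u \<noteq> []" "z \<in> set v" "length u = card T"
          using False \<open>z \<in> S - {m} - T\<close> finT
          by (auto dest: permutations_of_setD(1) length_finite_permutations_of_set)
        then show "\<phi> (u @ m # v) = c (card T) * (\<phi> u * \<phi> v)"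
          using \<phi>[OF perm[OF uv]] by simp
      qed
      also have "\<dots> = c (card T) * ((\<Sum>u\<in>permutations_of_set T. \<phi> u) *
          (\<Sum>v\<in>permutations_of_set (S - {m} - T). \<phi> v))"
        unfolding sum_product by (simp add: sum_distrib_left)
      also have "\<dots> = c (card T) * (A (card T) * A (Suc n - card T))"
        using IH[of T] V T False sub by auto
      finally show ?thesis
        using False finT by (simp add: g_def)
    qed
  qed
  also have "\<dots> = (\<Sum>k\<le>n. of_nat (n choose k) * g k)"
    using sum_Pow_card[OF fin, of g] card by simp
  also have "\<dots> = c0 * A (Suc n) + (\<Sum>k = 1..n. of_nat (n choose k) * g k)"
    unfolding atMost_atLeast0 by (subst sum.atLeast_Suc_atMost) (auto simp: g_def)
  also have "(\<Sum>k = 1..n. of_nat (n choose k) * g k) =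
      (\<Sum>k = 1..n. of_nat (n choose k) * (c k * (A k * A (Suc n - k))))"
    by (intro sum.cong) (auto simp: g_def)
  finally show ?thesis .
qed

section \<open>Descents and double descents of words\<close>

fun no_double_descent :: "nat list \<Rightarrow> bool" where
  "no_double_descent (a # b # c # w) \<longleftrightarrow> \<not> (a > b \<and> b > c) \<and> no_double_descent (b # c # w)"
| "no_double_descent _ \<longleftrightarrow> True"

fun desc :: "nat list \<Rightarrow> nat" where
  "desc (a # b # w) = (if a > b then 1 else 0) + desc (b # w)"
| "desc _ = 0"

lemma no_double_descent_nth:
  "no_double_descent w \<longleftrightarrow>
     (\<forall>i. Suc (Suc i) < length w \<longrightarrow> \<not> (w ! i > w ! Suc i \<and> w ! Suc i > w ! Suc (Suc i)))"
proof (induction w rule: no_double_descent.induct)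
  case (1 a b c w)
  have "(\<forall>i. R i) \<longleftrightarrow> R 0 \<and> (\<forall>i. R (Suc i))" for R :: "nat \<Rightarrow> bool"
    by (metis not0_implies_Suc)
  from this[of "\<lambda>i. Suc (Suc i) < length (a # b # c # w) \<longrightarrow> \<not> ((a # b # c # w) ! i > (a # b # c # w) ! Suc i
      \<and> (a # b # c # w) ! Suc i > (a # b # c # w) ! Suc (Suc i))"]
  show ?case
    using 1 by simp
qed auto

lemma no_double_descent_iff: "(\<forall>i. \<not> double_descent w i) \<longleftrightarrow> no_double_descent w"
proof
  assume *: "\<forall>i. \<not> double_descent w i"
  show "no_double_descent w"
    unfolding no_double_descent_nth
  proof (intro allI impI)
    fix i assume "Suc (Suc i) < length w"
    then show "\<not> (w ! i > w ! Suc i \<and> w ! Suc i > w ! Suc (Suc i))"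
      using *[rule_format, of "Suc (Suc i)"] by (simp add: double_descent_def letter_def)
  qed
next
  assume *: "no_double_descent w"
  show "\<forall>i. \<not> double_descent w i"
  proof (intro allI notI)
    fix i assume i: "double_descent w i"
    then obtain j where "i = Suc (Suc j)"
      by (metis double_descent_def add_2_eq_Suc le_Suc_ex)
    then show False
      using i * unfolding no_double_descent_nth
      by (auto simp: double_descent_def letter_def)
  qed
qed

text \<open>No decreasing triple contains the ascent from \<open>m\<close> to \<open>hd v\<close>,
  so each double descent lies inside \<open>u @ [m]\<close> or inside \<open>v\<close>.\<close>

lemma no_double_descent_append_Cons:
  assumes "v \<noteq> []" "m < hd v"
  shows "no_double_descent (u @ m # v) \<longleftrightarrow> no_double_descent (u @ [m]) \<and> no_double_descent v"
  using assms
proof (induction u rule: no_double_descent.induct)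
  case ("2_1")
  then show ?case by (cases v rule: no_double_descent.cases) auto
next
  case ("2_2" a)
  then show ?case by (cases v rule: no_double_descent.cases) auto
next
  case ("2_3" a b)
  then show ?case by (cases v rule: no_double_descent.cases) auto
qed auto

text \<open>Only comparisons between the final letter and letters of \<open>u\<close> matter, so a
  final minimum may be exchanged for \<open>0\<close>.\<close>

lemma no_double_descent_snoc_cong:
  assumes "\<forall>a\<in>set u. m < a" "\<forall>a\<in>set u. m' < a"
  shows "no_double_descent (u @ [m]) \<longleftrightarrow> no_double_descent (u @ [m'])"
  using assms by (induction u rule: no_double_descent.induct) auto

lemma no_double_descent_snoc2:
  assumes "\<forall>a\<in>set u. m < a" "m' < m"
  shows "no_double_descent (u @ [m, m']) \<longleftrightarrow> u = []"
  using assms by (induction u rule: no_double_descent.induct) auto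

text \<open>If only \<open>v\<close> is empty, the last letter of \<open>u\<close> forms a double
  descent with \<open>m\<close> and \<open>0\<close>; if \<open>v\<close> is nonempty, the ascent
  after \<open>m\<close> decouples the blocks.\<close>

lemma no_double_descent_snoc_split:
  assumes "0 < m" "\<forall>a\<in>set u. m < a" "\<forall>a\<in>set v. m < a"
  shows "no_double_descent (u @ m # v @ [0]) \<longleftrightarrow>
    (v = [] \<longrightarrow> u = []) \<and> no_double_descent (u @ [0]) \<and> no_double_descent (v @ [0])"
proof (cases "v = []")
  case True
  then show ?thesis
    using assms no_double_descent_snoc2[of u m 0] by auto
next
  case False
  then have "no_double_descent (u @ m # v @ [0]) \<longleftrightarrow>
      no_double_descent (u @ [m]) \<and> no_double_descent (v @ [0])"
    using assms by (intro no_double_descent_append_Cons) auto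
  moreover have "no_double_descent (u @ [m]) \<longleftrightarrow> no_double_descent (u @ [0])"
    using assms by (intro no_double_descent_snoc_cong) auto
  ultimately show ?thesis
    using False by simp
qed

text \<open>The only new triple consists of the last two letters of \<open>w\<close> and
  \<open>m\<close>, and its second step is always a descent.\<close>

lemma no_double_descent_snoc_iff:
  assumes "\<forall>a\<in>set w. m < a"
  shows "no_double_descent (w @ [m]) \<longleftrightarrow> no_double_descent w \<and>
     (length w \<ge> 2 \<longrightarrow> w ! (length w - 2) \<le> w ! (length w - 1))"
  using assms
proof (induction w rule: no_double_descent.induct)
  case (1 a b c w)
  then show ?case by (cases w rule: rev_cases) auto
qed auto

text \<open>The step into the minimal letter is a descent and the step out of it an ascent.\<close>

lemma desc_append_Cons:
  assumes "\<forall>a\<in>set u. m < a" "\<forall>a\<in>set v. m < a"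
  shows "desc (u @ m # v) = desc u + (if u = [] then 0 else 1) + desc v"
  using assms
proof (induction u rule: desc.induct)
  case "2_1"
  then show ?case by (cases v) auto
next
  case ("2_2" a)
  then show ?case by (cases v) auto
qed auto

section \<open>Descent and ascent statistics under removal of the first letter\<close>

lemma descents_Cons:
  "descents (a # w) = (if w \<noteq> [] \<and> a > hd w then {1} else {}) \<union> Suc ` descents w"
proof (intro set_eqI)
  fix i
  consider "i = 0" | "i = 1" | j where "i = Suc (Suc j)"
    by (metis One_nat_def not0_implies_Suc)
  then show "i \<in> descents (a # w) \<longleftrightarrow>
      i \<in> (if w \<noteq> [] \<and> a > hd w then {1} else {}) \<union> Suc ` descents w"
    by cases (auto simp: descents_def letter_def image_iff hd_conv_nth)
qed

lemma ascents_Cons: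
  "ascents (a # w) = (if w \<noteq> [] \<and> a < hd w then {1} else {}) \<union> Suc ` ascents w"
proof (intro set_eqI)
  fix i
  consider "i = 0" | "i = 1" | j where "i = Suc (Suc j)"
    by (metis One_nat_def not0_implies_Suc)
  then show "i \<in> ascents (a # w) \<longleftrightarrow>
      i \<in> (if w \<noteq> [] \<and> a < hd w then {1} else {}) \<union> Suc ` ascents w"
    by cases (auto simp: ascents_def letter_def image_iff hd_conv_nth)
qed

lemma descents_short: "descents [] = {}" "descents [a] = {}"
  by (auto simp: descents_def)

lemma ascents_short: "ascents [] = {}" "ascents [a] = {}"
  by (auto simp: ascents_def)

lemma card_shift_insert:
  assumes "finite A" "0 \<notin> A"
  shows "card {i \<in> (if c then {1} else {}) \<union> Suc ` A. R i} =
    (if c \<and> R 1 then 1 else 0) + card {i \<in> A. R (Suc i)}"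
proof -
  have "{i \<in> (if c then {1} else {}) \<union> Suc ` A. R i} =
     (if c \<and> R 1 then insert 1 (Suc ` {i \<in> A. R (Suc i)}) else Suc ` {i \<in> A. R (Suc i)})"
    by auto
  moreover have "1 \<notin> Suc ` {i \<in> A. R (Suc i)}"
    using assms by auto
  ultimately show ?thesis
    using assms by (simp add: card_image)
qed

text \<open>The predicate \<open>R\<close> stays arbitrary so that position parity, which flips
  under the shift, can be followed through an induction.\<close>

lemma card_descents_Cons:
  "card {i \<in> descents (a # b # w). R i} =
    (if a > b \<and> R 1 then 1 else 0) + card {i \<in> descents (b # w). R (Suc i)}"
  unfolding descents_Cons[of a "b # w"]
  by (subst card_shift_insert) (auto simp: descents_def)

lemma card_ascents_Cons:
  "card {i \<in> ascents (a # b # w). R i} =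
    (if a < b \<and> R 1 then 1 else 0) + card {i \<in> ascents (b # w). R (Suc i)}"
  unfolding ascents_Cons[of a "b # w"]
  by (subst card_shift_insert) (auto simp: ascents_def)

lemma des_eq_desc: "des w = desc w"
proof (induction w rule: desc.induct)
  case (1 a b w)
  then show ?case
    using card_descents_Cons[of a b w "\<lambda>_. True"] by (simp add: des_def)
qed (simp_all add: des_def descents_short)

text \<open>
  The weights \<open>p\<close>, \<open>q\<close> belong to descents and ascents at odd positions, \<open>r\<close>, \<open>s\<close> to those at even
  positions; removing the first letter swaps the two pairs.
\<close>

fun parity_weight :: "'a \<Rightarrow> 'a \<Rightarrow> 'a \<Rightarrow> 'a \<Rightarrow> nat list \<Rightarrow> 'a::comm_semiring_1" where
  "parity_weight p q r s (a # b # w) = (if a > b then p else q) * parity_weight r s p q (b # w)"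
| "parity_weight p q r s _ = 1"

text \<open>Both equations are proved together, since dropping the first letter turns each into the
  other.\<close>

lemma parity_weight_eq:
  assumes "distinct w"
  shows "parity_weight x 1 1 y w = x ^ des1 w * y ^ asc0 w"
    and "parity_weight 1 y x 1 w = x ^ card {i \<in> descents w. even i} * y ^ card {i \<in> ascents w. odd i}"
  using assms
proof (induction w rule: desc.induct)
  case (1 a b w)
  { case 1
    then show ?case
      using "1.IH" by (auto simp: des1_def asc0_def card_descents_Cons card_ascents_Cons algebra_simps)
  next
    case 2
    then show ?case
      using "1.IH"
      by (auto simp: des1_def asc0_def card_descents_Cons card_ascents_Cons algebra_simps)
  }
qed (simp_all add: des1_def asc0_def descents_short ascents_short)

text \<open>The descent into \<open>m\<close> is at position \<open>length u\<close>, the ascent out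
  of it at the next one, and \<open>v\<close> starts two positions after the end of
  \<open>u\<close>, hence at a position of the parity of \<open>length u\<close>.\<close>

lemma parity_weight_append_Cons:
  assumes "\<forall>a\<in>set u. m < a" "\<forall>a\<in>set v. m < a"
  shows "parity_weight p q r s (u @ m # v) = parity_weight p q r s u *
    (if u = [] then 1 else if odd (length u) then p else r) *
    (if v = [] then 1 else if odd (length u) then s else q) *
    (if odd (length u) then parity_weight p q r s v else parity_weight r s p q v)"
  using assms
proof (induction p q r s u rule: parity_weight.induct)
  case ("2_1" p q r s)
  then show ?case by (cases v) auto
next
  case ("2_2" p q r s a)
  then show ?case by (cases v) (auto simp: mult.assoc)
qed (auto simp: algebra_simps)

section \<open>Andre permutations\<close>

text \<open>The value at index \<open>0\<close> only serves to count the empty ended Simsun word.\<close>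

fun andre_poly :: "'a::comm_semiring_1 \<Rightarrow> 'a \<Rightarrow> nat \<Rightarrow> 'a" where
  "andre_poly P Q 0 = 1"
| "andre_poly P Q (Suc 0) = 1"
| "andre_poly P Q (Suc (Suc n)) = (if even n then 1 else P) * andre_poly P Q (Suc n) +
     (\<Sum>k = 1..n. of_nat (n choose k) * ((if even k \<and> odd n then P else 1) * Q *
        (andre_poly P Q k * andre_poly P Q (Suc n - k))))"

text \<open>A cut of the word replaces the valley position, and \<open>w2\<close>, \<open>w4\<close>
  become the runs of larger letters next to \<open>a\<close>. The left run appears reversed, which
  leaves its maximum unchanged.\<close>

definition valleys_andre :: "nat list \<Rightarrow> bool" where
  "valleys_andre w \<longleftrightarrow> (\<forall>p a s. w = p @ a # s \<and> p \<noteq> [] \<and> s \<noteq> [] \<and> a < last p \<and> a < hd s \<longrightarrow>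
     Max (set (takeWhile (\<lambda>b. a < b) (rev p))) < Max (set (takeWhile (\<lambda>b. a < b) s)))"

text \<open>The minimal letter stops every run of larger letters, so valleys inside a block see the
  same runs as before; at \<open>m\<close> itself the runs are all of \<open>u\<close> and all of
  \<open>v\<close>.\<close>

lemma valleys_andre_append_Cons:
  assumes u: "\<forall>a\<in>set u. m < a" and v: "\<forall>a\<in>set v. m < a"
  shows "valleys_andre (u @ m # v) \<longleftrightarrow>
    valleys_andre u \<and> valleys_andre v \<and> (u \<noteq> [] \<and> v \<noteq> [] \<longrightarrow> Max (set u) < Max (set v))"
proof (intro iffI conjI impI)
  assume *: "valleys_andre (u @ m # v)"
  show "valleys_andre u"
    unfolding valleys_andre_def
  proof (intro allI impI, elim conjE)
    fix p a s assume uE: "u = p @ a # s" and "p \<noteq> []" "s \<noteq> []" "a < last p" "a < hd s"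
    moreover have "takeWhile (\<lambda>b. a < b) (s @ m # v) = takeWhile (\<lambda>b. a < b) s"
      using u uE by (intro takeWhile_tail) auto
    ultimately show "Max (set (takeWhile (\<lambda>b. a < b) (rev p))) < Max (set (takeWhile (\<lambda>b. a < b) s))"
      using *[unfolded valleys_andre_def, rule_format, of p a "s @ m # v"] by simp
  qed
  show "valleys_andre v"
    unfolding valleys_andre_def
  proof (intro allI impI, elim conjE)
    fix p a s assume vE: "v = p @ a # s" and "p \<noteq> []" "s \<noteq> []" "a < last p" "a < hd s"
    moreover have "takeWhile (\<lambda>b. a < b) (rev p @ m # rev u) = takeWhile (\<lambda>b. a < b) (rev p)"
      using v vE by (intro takeWhile_tail) auto
    ultimately show "Max (set (takeWhile (\<lambda>b. a < b) (rev p))) < Max (set (takeWhile (\<lambda>b. a < b) s))"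
      using *[unfolded valleys_andre_def, rule_format, of "u @ m # p" a s] by simp
  qed
  have tw: "takeWhile (\<lambda>b. m < b) (rev u) = rev u" "takeWhile (\<lambda>b. m < b) v = v"
    using u v by (simp_all add: takeWhile_eq_all_conv)
  assume "u \<noteq> [] \<and> v \<noteq> []"
  then have "Max (set (takeWhile (\<lambda>b. m < b) (rev u))) < Max (set (takeWhile (\<lambda>b. m < b) v))"
    using *[unfolded valleys_andre_def, rule_format, of u m v] u v by simp
  then show "Max (set u) < Max (set v)"
    unfolding tw set_rev .
next
  assume *: "valleys_andre u \<and> valleys_andre v \<and> (u \<noteq> [] \<and> v \<noteq> [] \<longrightarrow> Max (set u) < Max (set v))"
  show "valleys_andre (u @ m # v)"
    unfolding valleys_andre_def
  proof (intro allI impI, elim conjE)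
    fix p a s assume eq: "u @ m # v = p @ a # s" and ps: "p \<noteq> []" "s \<noteq> []" "a < last p" "a < hd s"
    consider "p = u" "a = m" "s = v" | s' where "u = p @ a # s'" "s = s' @ m # v"
      | p' where "v = p' @ a # s" "p = u @ m # p'"
      using eq by (auto simp: append_eq_append_conv2 Cons_eq_append_conv append_eq_Cons_conv)
    then show "Max (set (takeWhile (\<lambda>b. a < b) (rev p))) < Max (set (takeWhile (\<lambda>b. a < b) s))"
    proof cases
      case 1
      have tw: "takeWhile (\<lambda>b. m < b) (rev u) = rev u" "takeWhile (\<lambda>b. m < b) v = v"
        using u v by (simp_all add: takeWhile_eq_all_conv)
      show ?thesis
        unfolding 1 tw set_rev using * ps 1 by blast
    next
      case 2
      \<comment> \<open>Since \<open>m < a\<close>, a valley letter of \<open>u\<close> is not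
        followed directly by \<open>m\<close>, and its right run ends before
        \<open>m\<close>.\<close>
      have "m < a"
        using u 2 by simp
      then have "s' \<noteq> []" "takeWhile (\<lambda>b. a < b) (s' @ m # v) = takeWhile (\<lambda>b. a < b) s'"
        using 2 ps by (auto intro: takeWhile_tail)
      then show ?thesis
        using 2 * ps by (auto simp: valleys_andre_def)
    next
      case 3
      have "m < a"
        using v 3 by simp
      then have "p' \<noteq> []" "takeWhile (\<lambda>b. a < b) (rev p' @ m # rev u) = takeWhile (\<lambda>b. a < b) (rev p')"
        using 3 ps by (auto intro: takeWhile_tail)
      then show ?thesis
        using 3 * ps by (auto simp: valleys_andre_def)
    qed
  qed
qed

section \<open>Letter factorizations as runs of larger letters\<close>

lemma longest_prefix_eq_takeWhile:
  assumes "xs @ ys = zs" "\<forall>b\<in>set xs. R b"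
    and "\<forall>v. prefix v zs \<and> (\<forall>b\<in>set v. R b) \<longrightarrow> length v \<le> length xs"
  shows "xs = takeWhile R zs"
proof -
  have "takeWhile R zs = xs @ takeWhile R ys"
    using assms(1,2) by (metis takeWhile_append2)
  moreover have "length (takeWhile R zs) \<le> length xs"
    using assms(3) by (meson set_takeWhileD takeWhile_is_prefix)
  ultimately show ?thesis
    by simp
qed

text \<open>Maximality determines both runs; the suffix \<open>w2\<close> is handled as a prefix of
  the reversed word.\<close>

lemma letter_factorization_unique:
  assumes "letter_factorization w i (w1, w2, a, w4, w5)"
  shows "a = letter w i" "w2 = rev (takeWhile (\<lambda>b. letter w i < b) (rev (take (i - 1) w)))"
    "w4 = takeWhile (\<lambda>b. letter w i < b) (drop i w)"
proof -
  show a: "a = letter w i"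
    using assms by (simp add: letter_factorization_def)
  have *: "w1 @ w2 = take (i - 1) w" "w4 @ w5 = drop i w" "\<forall>b\<in>set w2. b > letter w i"
    "\<forall>v. suffix v (take (i - 1) w) \<and> (\<forall>b\<in>set v. b > letter w i) \<longrightarrow> length v \<le> length w2"
    "\<forall>b\<in>set w4. b > letter w i"
    "\<forall>v. prefix v (drop i w) \<and> (\<forall>b\<in>set v. b > letter w i) \<longrightarrow> length v \<le> length w4"
    using assms unfolding letter_factorization_def by auto
  show "w4 = takeWhile (\<lambda>b. letter w i < b) (drop i w)"
    using *(2,5,6) by (rule longest_prefix_eq_takeWhile)
  have "rev w2 = takeWhile (\<lambda>b. letter w i < b) (rev (take (i - 1) w))"
  proof (rule longest_prefix_eq_takeWhile)
    show "rev w2 @ rev w1 = rev (take (i - 1) w)"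
      using *(1) by (metis rev_append)
    show "\<forall>v. prefix v (rev (take (i - 1) w)) \<and> (\<forall>b\<in>set v. letter w i < b) \<longrightarrow>
        length v \<le> length (rev w2)"
      using *(4) by (metis length_rev rev_rev_ident set_rev suffix_to_prefix)
  qed (use *(3) in auto)
  then show "w2 = rev (takeWhile (\<lambda>b. letter w i < b) (rev (take (i - 1) w)))"
    by (metis rev_rev_ident)
qed

lemma valleys_andre_iff:
  "(\<forall>i. valley w i \<longrightarrow>
        (\<forall>w1 w2 a w4 w5. letter_factorization w i (w1, w2, a, w4, w5) \<longrightarrow>
           Max (set w2) < Max (set w4))) \<longleftrightarrow> valleys_andre w" (is "?L \<longleftrightarrow> _")
proof -
  define R where "R p a s \<longleftrightarrow> Max (set (takeWhile (\<lambda>b. a < b) (rev p))) < Max (set (takeWhile (\<lambda>b. a < b) s))"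
    for p s :: "nat list" and a
  \<comment> \<open>Existence and uniqueness reduce the quantifier over factorizations to the one
    pair of runs given by \<open>takeWhile\<close>.\<close>
  have "?L \<longleftrightarrow> (\<forall>i. valley w i \<longrightarrow> R (take (i - 1) w) (letter w i) (drop i w))"
    using letter_factorization_exists[of w] letter_factorization_unique[of w]
    unfolding R_def by (metis set_rev)
  also have "\<dots> \<longleftrightarrow> valleys_andre w"
  proof
    assume *: "\<forall>i. valley w i \<longrightarrow> R (take (i - 1) w) (letter w i) (drop i w)"
    show "valleys_andre w"
      unfolding valleys_andre_def
    proof (intro allI impI, elim conjE)
      fix p a s assume w: "w = p @ a # s" and ps: "p \<noteq> []" "s \<noteq> []" "a < last p" "a < hd s"
      \<comment> \<open>Positions start at 1, so \<open>a\<close> stands at position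
        \<open>Suc (length p)\<close>.\<close>
      have "valley w (Suc (length p))"
        using w ps by (auto simp: valley_def letter_def nth_append last_conv_nth hd_conv_nth Suc_le_eq)
      then have "R p a s"
        using * w by (force simp: letter_def)
      then show "Max (set (takeWhile (\<lambda>b. a < b) (rev p))) < Max (set (takeWhile (\<lambda>b. a < b) s))"
        by (simp add: R_def)
    qed
  next
    assume *: "valleys_andre w"
    show "\<forall>i. valley w i \<longrightarrow> R (take (i - 1) w) (letter w i) (drop i w)"
    proof (intro allI impI)
      fix i assume v: "valley w i"
      then obtain j where i: "i = Suc (Suc j)"
        by (metis valley_def add_2_eq_Suc le_Suc_ex)
      have len: "Suc (Suc j) < length w"
        using v i by (simp add: valley_def)
      have "w = take (Suc j) w @ w ! Suc j # drop (Suc (Suc j)) w"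
        using len by (intro id_take_nth_drop) simp
      moreover have "last (take (Suc j) w) = w ! j" "hd (drop (Suc (Suc j)) w) = w ! Suc (Suc j)"
        using len by (simp_all add: take_Suc_conv_app_nth hd_drop_conv_nth)
      moreover have "take (Suc j) w \<noteq> []" "drop (Suc (Suc j)) w \<noteq> []"
        using len by auto
      ultimately show "R (take (i - 1) w) (letter w i) (drop i w)"
        using * v i unfolding R_def valleys_andre_def valley_def letter_def by simp
    qed
  qed
  finally show ?thesis .
qed

text \<open>
  For words with positive letters, appending \<open>0\<close> to the word expresses the absence of double
  descents together with the final ascent.
\<close>

definition andre_word :: "nat list \<Rightarrow> bool" where
  "andre_word w \<longleftrightarrow> no_double_descent (w @ [0]) \<and> valleys_andre w"

lemma andre_permutations_eq: "andre_permutations n = {w \<in> permutations_of_set {1..n}. andre_word w}"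
proof (rule set_eqI)
  fix w
  show "w \<in> andre_permutations n \<longleftrightarrow> w \<in> {w \<in> permutations_of_set {1..n}. andre_word w}"
  proof (cases "w \<in> permutations_of_set {1..n}")
    case True
    then have w: "set w = {1..n}" "distinct w" "length w = n"
      by (auto simp: permutations_of_set_def dest: distinct_card)
    then have "\<forall>a\<in>set w. 0 < a"
      by simp
    note no_double_descent_snoc_iff[OF this]
    \<comment> \<open>Distinctness sharpens the weak inequality of
      \<open>no_double_descent_snoc_iff\<close> to a strict final ascent.\<close>
    moreover have "w ! (n - 2) \<noteq> w ! (n - 1)" if "n \<ge> 2"
      using w that by (simp add: nth_eq_iff_index_eq)
    moreover have "letter w (n - 1) = w ! (n - 2)" "letter w n = w ! (n - 1)"
      by (simp_all add: letter_def numeral_2_eq_2)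
    ultimately show ?thesis
      using True w(3)
      unfolding andre_permutations_def andre_word_def valleys_andre_iff no_double_descent_iff
      by auto
  qed (simp add: andre_permutations_def)
qed

lemma andre_word_append_Cons:
  assumes "0 < m" "\<forall>a\<in>set u. m < a" "\<forall>a\<in>set v. m < a"
  shows "andre_word (u @ m # v) \<longleftrightarrow> (v = [] \<longrightarrow> u = []) \<and> andre_word u \<and> andre_word v \<and>
    (u \<noteq> [] \<and> v \<noteq> [] \<longrightarrow> Max (set u) < Max (set v))"
  using no_double_descent_snoc_split[OF assms] valleys_andre_append_Cons[OF assms(2,3)]
  unfolding andre_word_def by auto

text \<open>Descents are never adjacent, so they occupy disjoint pairs of letters; a first letter
  that does not start a descent belongs to no pair, which is the correction needed for the
  induction.\<close>

lemma desc_le_of_no_double_descent: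
  assumes "no_double_descent (a # w)"
  shows "2 * desc (a # w) \<le> length (a # w) - (if w = [] \<or> a \<le> hd w then 1 else 0)"
  using assms
proof (induction "a # w" arbitrary: a w rule: no_double_descent.induct)
  case (1 a b c w)
  then show ?case by (auto split: if_splits)
qed auto

text \<open>Appending \<open>0\<close> adds one descent and one letter, and the resulting word still
  has no double descent.\<close>

lemma desc_less_of_andre_word:
  assumes "andre_word w" "w \<noteq> []" "\<forall>a\<in>set w. 0 < a"
  shows "2 * desc w < length w"
proof -
  obtain a w' where w: "w = a # w'"
    using assms(2) by (cases w) auto
  have "desc (w @ [0]) = desc w + 1"
    using desc_append_Cons[of w 0 "[]"] assms by simp
  moreover have "2 * desc (w @ [0]) \<le> length (w @ [0])"
    using desc_le_of_no_double_descent[of a "w' @ [0]"] assms(1) w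
    by (auto simp: andre_word_def split: if_splits)
  ultimately show ?thesis
    by simp
qed

text \<open>
  An Andre permutation of length \<open>n \<ge> 1\<close> has at most \<open>(n - 1) div 2\<close> descents, so the
  subtraction in the exponent does not truncate. Compared with the exponent \<open>n div 2 - des\<close> of the
  theorem one factor \<open>P\<close> is split off for even \<open>n\<close>, which keeps the recurrence free of division.
\<close>

definition andre_weight :: "'a::comm_semiring_1 \<Rightarrow> 'a \<Rightarrow> nat list \<Rightarrow> 'a" where
  "andre_weight P Q w =
     (if andre_word w then P ^ ((length w - 1) div 2 - desc w) * Q ^ desc w else 0)"

text \<open>Compares the exponent of \<open>P\<close> of a word with those of its blocks, of lengths
  \<open>a\<close>, \<open>b\<close> with \<open>i\<close>, \<open>j\<close> descents; the
  \<open>1\<close> is the descent into the minimum. Rounding yields an extra factor exactly when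
  both lengths are even.\<close>

lemma half_length_split:
  fixes a b n i j :: nat
  assumes "2 * i < a" "2 * j < b" "a + b = Suc n"
  shows "(a + b) div 2 - (i + j + 1) =
    (if even a \<and> odd n then 1 else 0) + (((a - 1) div 2 - i) + ((b - 1) div 2 - j))"
proof -
  obtain a' b' where ab: "a = Suc a'" "b = Suc b'"
    using assms(1,2) by (metis less_nat_zero_code not0_implies_Suc)
  have n: "n = Suc (a' + b')"
    using assms(3) ab by simp
  have *: "i \<le> a' div 2" "j \<le> b' div 2"
    using assms(1,2) ab by auto
  have "Suc (Suc (a' + b')) div 2 = (if odd a' \<and> odd n then 1 else 0) + 1 + a' div 2 + b' div 2"
    unfolding n by (cases "even a'"; cases "even b'") (auto elim!: evenE oddE)
  then show ?thesis
    using ab * by simp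
qed

lemma min_split_of_permutations:
  fixes S :: "nat set"
  assumes "finite S" "u @ Min S # v \<in> permutations_of_set S"
  shows "\<forall>a\<in>set u. Min S < a" "\<forall>a\<in>set v. Min S < a" "length u + length v + 1 = card S"
    "S = insert (Min S) (set u \<union> set v)" "set u \<inter> set v = {}"
proof -
  have *: "set (u @ Min S # v) = S" "distinct (u @ Min S # v)"
    using assms(2) by (simp_all only: permutations_of_set_def mem_Collect_eq)
  then show "S = insert (Min S) (set u \<union> set v)" "set u \<inter> set v = {}"
    by auto
  show "length u + length v + 1 = card S"
    using length_finite_permutations_of_set[OF assms(2)] by simp
  have "Min S < a" if "a \<in> set u \<union> set v" for a
  proof -
    have "a \<in> S" "a \<noteq> Min S"
      using that * by auto
    then show ?thesis
      using assms(1) by (metis Min_le le_neq_implies_less)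
  qed
  then show "\<forall>a\<in>set u. Min S < a" "\<forall>a\<in>set v. Min S < a"
    by auto
qed

lemma sum_andre_weight:
  assumes "finite S" "S \<noteq> {}" "0 \<notin> S"
  shows "(\<Sum>w\<in>permutations_of_set S. andre_weight P Q w) = andre_poly P Q (card S)"
  using assms
proof (induction "card S" arbitrary: S rule: less_induct)
  case less
  consider "card S = 1" | n where "card S = Suc (Suc n)"
    using less.prems by (metis One_nat_def card_0_eq not0_implies_Suc)
  then show ?case
  proof cases
    case 1
    then obtain a where "S = {a}"
      by (auto simp: card_1_singleton_iff)
    then show ?thesis
      by (simp add: andre_weight_def andre_word_def valleys_andre_def Cons_eq_append_conv)
  next
    case (2 n)
    define m z where "m = Min S" and "z = Max S"
    note fin = less.prems(1)
    have S: "m \<in> S" "z \<in> S"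
      using less.prems by (auto simp: m_def z_def)
    have "z \<noteq> m"
    proof
      assume "z = m"
      then have "S \<subseteq> {m}"
        using fin by (metis Max_ge Min_le antisym insertCI m_def subsetI z_def)
      then have "card S \<le> 1"
        using card_mono[of "{m}" S] by simp
      with 2 show False by simp
    qed
    have m0: "0 < m"
      using S less.prems(3) by (metis gr0I)
    note split = min_split_of_permutations[OF fin, folded m_def]
    have pos: "\<forall>a\<in>set u. 0 < a" "\<forall>a\<in>set v. 0 < a"
      if "u @ m # v \<in> permutations_of_set S" for u v
      using split(1,2)[OF that] m0 by auto
    show ?thesis
      unfolding 2 andre_poly.simps
    proof (rule sum_permutations_of_set_rec2[OF fin 2 S \<open>z \<noteq> m\<close>])
      fix u v assume w: "u @ m # v \<in> permutations_of_set S"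
      note sp = split[OF w]
      note aw = andre_word_append_Cons[OF m0 sp(1,2)]
      have zle: "a \<le> z" if "a \<in> set u \<union> set v" for a
        using that sp(4) fin by (auto simp: z_def)
      \<comment> \<open>Either \<open>v\<close> is empty and the final ascent fails, or the valley
        condition at \<open>m\<close> fails.\<close>
      { assume "z \<in> set u"
        then have "Max (set u) = z"
          using zle by (intro Max_eqI) auto
        moreover have "Max (set v) \<le> z" if "v \<noteq> []"
          using zle that by simp
        ultimately have "\<not> andre_word (u @ m # v)"
          unfolding aw using \<open>z \<in> set u\<close> by (metis empty_iff leD list.set(1))
        then show "andre_weight P Q (u @ m # v) = 0"
          by (simp add: andre_weight_def) }
      \<comment> \<open>By distinctness \<open>z\<close> is absent from \<open>u\<close>, so the
        condition on the maxima holds automatically.\<close>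
      { assume u: "u \<noteq> []" and "z \<in> set v"
        then have "Max (set v) = z"
          using zle by (intro Max_eqI) auto
        moreover have "Max (set u) < z"
          using zle u sp(5) \<open>z \<in> set v\<close> by (metis Max_in disjoint_iff finite_set le_neq_implies_less set_empty UnI1)
        moreover have "v \<noteq> []"
          using \<open>z \<in> set v\<close> by auto
        ultimately have iff: "andre_word (u @ m # v) \<longleftrightarrow> andre_word u \<and> andre_word v"
          using aw by auto
        show "andre_weight P Q (u @ m # v) =
           (if even (length u) \<and> odd n then P else 1) * Q * (andre_weight P Q u * andre_weight P Q v)"
        proof (cases "andre_word u \<and> andre_word v")
          case True
          have d: "desc (u @ m # v) = desc u + desc v + 1"
            using desc_append_Cons[OF sp(1,2)] u by simp
          have b: "2 * desc u < length u" "2 * desc v < length v"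
            using True pos[OF w] u \<open>v \<noteq> []\<close> desc_less_of_andre_word by auto
          have len: "length u + length v = Suc n"
            using sp(3) 2 by simp
          have "(length u + length v) div 2 - (desc u + desc v + 1) =
             (if even (length u) \<and> odd n then 1 else 0) +
             (((length u - 1) div 2 - desc u) + ((length v - 1) div 2 - desc v))"
            using b len by (rule half_length_split)
          then have "P ^ ((length u + length v) div 2 - (desc u + desc v + 1)) =
             (if even (length u) \<and> odd n then P else 1) *
             (P ^ ((length u - 1) div 2 - desc u) * P ^ ((length v - 1) div 2 - desc v))"
            by (simp add: power_add)
          then show ?thesis
            using True iff d by (simp add: andre_weight_def power_add mult_ac)
        qed (use iff in \<open>auto simp: andre_weight_def\<close>) }
    next
      fix v assume w: "m # v \<in> permutations_of_set S"
      then have w': "[] @ m # v \<in> permutations_of_set S"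
        by simp
      note sp = split[OF w']
      have v: "v \<noteq> []" "length v = Suc n"
        using sp(3) 2 by auto
      have iff: "andre_word (m # v) \<longleftrightarrow> andre_word v"
        using andre_word_append_Cons[OF m0 sp(1,2)] v by (auto simp: andre_word_def valleys_andre_def)
      show "andre_weight P Q (m # v) = (if even n then 1 else P) * andre_weight P Q v"
      proof (cases "andre_word v")
        case True
        have "2 * desc v < length v"
          using True v(1) pos(2)[OF w'] by (rule desc_less_of_andre_word)
        \<comment> \<open>Prefixing the minimum adds a letter but no descent; the halved length
          grows exactly for odd \<open>n\<close>.\<close>
        then have "Suc n div 2 - desc v = (if even n then 0 else 1) + (n div 2 - desc v)"
          using v(2) by (auto elim!: oddE)
        moreover have "desc (m # v) = desc v"
          using desc_append_Cons[OF sp(1,2)] by simp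
        ultimately show ?thesis
          using True iff v(2) by (simp add: andre_weight_def power_add mult_ac)
      qed (use iff in \<open>simp add: andre_weight_def\<close>)
    next
      fix T assume "T \<subseteq> S - {m}" "T \<noteq> {}"
      moreover from this have "card T < card S"
        using fin S by (intro psubset_card_mono) auto
      ultimately show "(\<Sum>u\<in>permutations_of_set T. andre_weight P Q u) = andre_poly P Q (card T)"
        using less.prems fin by (intro less.hyps) (auto intro: finite_subset)
    qed
  qed
qed

section \<open>Simsun permutations\<close>

text \<open>Allowing every threshold \<open>k\<close> makes the notion meaningful for arbitrary
  letter sets, as the recursion into blocks requires.\<close>

definition simsun_word :: "nat list \<Rightarrow> bool" where
  "simsun_word w \<longleftrightarrow> (\<forall>k. no_double_descent (filter (\<lambda>a. a \<le> k) w))"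

definition simsun_ended_word :: "nat list \<Rightarrow> bool" where
  "simsun_ended_word w \<longleftrightarrow> (\<forall>k. no_double_descent (filter (\<lambda>a. a \<le> k) w @ [0]))"

text \<open>Thresholds below \<open>m\<close> leave nothing, and the others fall under
  \<open>no_double_descent_snoc_split\<close>. The last clause says that, as the threshold grows,
  \<open>v\<close> receives a letter no later than \<open>u\<close>.\<close>

lemma simsun_ended_word_append_Cons:
  assumes "0 < m" and u: "\<forall>a\<in>set u. m < a" and v: "\<forall>a\<in>set v. m < a"
  shows "simsun_ended_word (u @ m # v) \<longleftrightarrow> simsun_ended_word u \<and> simsun_ended_word v \<and>
    (\<forall>k. filter (\<lambda>a. a \<le> k) v = [] \<longrightarrow> filter (\<lambda>a. a \<le> k) u = [])"
proof -
  have "no_double_descent (filter (\<lambda>a. a \<le> k) (u @ m # v) @ [0]) \<longleftrightarrow>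
      (filter (\<lambda>a. a \<le> k) v = [] \<longrightarrow> filter (\<lambda>a. a \<le> k) u = []) \<and>
      no_double_descent (filter (\<lambda>a. a \<le> k) u @ [0]) \<and>
      no_double_descent (filter (\<lambda>a. a \<le> k) v @ [0])" for k
  proof (cases "m \<le> k")
    case True
    then show ?thesis
      using assms no_double_descent_snoc_split[of m "filter (\<lambda>a. a \<le> k) u" "filter (\<lambda>a. a \<le> k) v"]
      by simp
  next
    case False
    then have "filter (\<lambda>a. a \<le> k) u = []" "filter (\<lambda>a. a \<le> k) v = []"
      using u v by (auto simp: filter_empty_conv)
    then show ?thesis
      using False by simp
  qed
  then show ?thesis
    unfolding simsun_ended_word_def by blast
qed

text \<open>In each restriction that keeps \<open>m\<close>, this letter closes the left block like
  a final \<open>0\<close> and is followed by an ascent or by nothing.\<close>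

lemma simsun_word_append_Cons:
  assumes "0 < m" and u: "\<forall>a\<in>set u. m < a" and v: "\<forall>a\<in>set v. m < a"
  shows "simsun_word (u @ m # v) \<longleftrightarrow> simsun_ended_word u \<and> simsun_word v"
proof -
  have "no_double_descent (filter (\<lambda>a. a \<le> k) (u @ m # v)) \<longleftrightarrow>
      no_double_descent (filter (\<lambda>a. a \<le> k) u @ [0]) \<and>
      no_double_descent (filter (\<lambda>a. a \<le> k) v)" for k
  proof (cases "m \<le> k")
    case True
    define u' v' where "u' = filter (\<lambda>a. a \<le> k) u" and "v' = filter (\<lambda>a. a \<le> k) v"
    have u': "\<forall>a\<in>set u'. m < a" and v': "\<forall>a\<in>set v'. m < a"
      using u v by (auto simp: u'_def v'_def)
    have "no_double_descent (u' @ m # v') \<longleftrightarrow> no_double_descent (u' @ [m]) \<and> no_double_descent v'"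
      using v' no_double_descent_append_Cons[of v' m u'] by (cases v') auto
    moreover have "no_double_descent (u' @ [m]) \<longleftrightarrow> no_double_descent (u' @ [0])"
      using u' \<open>0 < m\<close> by (intro no_double_descent_snoc_cong) auto
    ultimately show ?thesis
      using True by (simp add: u'_def v'_def)
  next
    case False
    then have "filter (\<lambda>a. a \<le> k) u = []" "filter (\<lambda>a. a \<le> k) v = []"
      using u v by (auto simp: filter_empty_conv)
    then show ?thesis
      using False by simp
  qed
  then show ?thesis
    unfolding simsun_word_def simsun_ended_word_def by blast
qed

definition simsun_weight :: "'a::comm_semiring_1 \<Rightarrow> nat list \<Rightarrow> 'a" where
  "simsun_weight t w = (if simsun_word w then t ^ desc w else 0)"

definition simsun_ended_weight :: "'a::comm_semiring_1 \<Rightarrow> nat list \<Rightarrow> 'a" where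
  "simsun_ended_weight t w = (if simsun_ended_word w then t ^ desc w else 0)"

text \<open>For \<open>P = 1\<close> the parity factors of the Andre recurrence disappear. Here the
  empty set is included, for use as an empty left block in \<open>sum_simsun_weight\<close>.\<close>

lemma sum_simsun_ended_weight:
  assumes "finite S" "0 \<notin> S"
  shows "(\<Sum>w\<in>permutations_of_set S. simsun_ended_weight t w) = andre_poly 1 t (card S)"
  using assms
proof (induction "card S" arbitrary: S rule: less_induct)
  case less
  note fin = less.prems(1)
  consider "card S = 0" | "card S = 1" | n where "card S = Suc (Suc n)"
    by (metis One_nat_def not0_implies_Suc)
  then show ?case
  proof cases
    case 1
    then show ?thesis
      using fin by (simp add: simsun_ended_weight_def simsun_ended_word_def)
  next
    case 2
    then obtain a where "S = {a}"
      by (auto simp: card_1_singleton_iff)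
    then show ?thesis
      by (simp add: simsun_ended_weight_def simsun_ended_word_def)
  next
    case (3 n)
    define m z where "m = Min S" and "z = Min (S - {m})"
    have "S \<noteq> {}"
      using 3 by auto
    then have "m \<in> S"
      using fin by (simp add: m_def)
    then have "card (S - {m}) = Suc n"
      using 3 by simp
    then have "S - {m} \<noteq> {}"
      by (metis card.empty nat.distinct(1))
    then have "z \<in> S - {m}"
      using fin unfolding z_def by (intro Min_in) auto
    then have S: "m \<in> S" "z \<in> S" "z \<noteq> m"
      using \<open>m \<in> S\<close> by auto
    have m0: "0 < m"
      using S less.prems(2) by (metis gr0I)
    note split = min_split_of_permutations[OF fin, folded m_def]
    have zle: "z \<le> a" if "u @ m # v \<in> permutations_of_set S" "a \<in> set u \<union> set v" for a u v
    proof -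
      have "a \<in> S - {m}"
        using split(1,2,4)[OF that(1)] that(2) by blast
      then show ?thesis
        using fin by (simp add: z_def)
    qed
    have "(\<Sum>w\<in>permutations_of_set S. simsun_ended_weight t w) = 1 * andre_poly 1 t (Suc n) +
       (\<Sum>k = 1..n. of_nat (n choose k) * (t * (andre_poly 1 t k * andre_poly 1 t (Suc n - k))))"
    proof (rule sum_permutations_of_set_rec2[OF fin 3 S])
      fix u v assume w: "u @ m # v \<in> permutations_of_set S"
      note sp = split[OF w]
      note sw = simsun_ended_word_append_Cons[OF m0 sp(1,2)]
      \<comment> \<open>At threshold \<open>z\<close> the right block is emptied while the left one
        keeps \<open>z\<close>.\<close>
      { assume "z \<in> set u"
        then have "z \<notin> set v"
          using sp(5) by auto
        then have "filter (\<lambda>a. a \<le> z) v = []"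
          using zle[OF w] by (force simp: filter_empty_conv)
        moreover have "filter (\<lambda>a. a \<le> z) u \<noteq> []"
          using \<open>z \<in> set u\<close> by (auto simp: filter_empty_conv)
        ultimately show "simsun_ended_weight t (u @ m # v) = 0"
          using sw by (auto simp: simsun_ended_weight_def) }
      { assume u: "u \<noteq> []" and z: "z \<in> set v"
        \<comment> \<open>A threshold that empties \<open>v\<close> lies below \<open>z\<close>,
          which bounds all letters of \<open>u\<close> from below.\<close>
        have "filter (\<lambda>a. a \<le> k) u = []" if "filter (\<lambda>a. a \<le> k) v = []" for k
          using that z zle[OF w] by (force simp: filter_empty_conv)
        then have "simsun_ended_word (u @ m # v) \<longleftrightarrow> simsun_ended_word u \<and> simsun_ended_word v"
          using sw by auto
        then show "simsun_ended_weight t (u @ m # v) =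
            t * (simsun_ended_weight t u * simsun_ended_weight t v)"
          using desc_append_Cons[OF sp(1,2)] u
          by (simp add: simsun_ended_weight_def power_add mult_ac) }
    next
      fix v assume w: "m # v \<in> permutations_of_set S"
      then have "[] @ m # v \<in> permutations_of_set S"
        by simp
      note sp = split[OF this]
      show "simsun_ended_weight t (m # v) = 1 * simsun_ended_weight t v"
        using simsun_ended_word_append_Cons[OF m0 sp(1,2)] desc_append_Cons[OF sp(1,2)]
        by (simp add: simsun_ended_weight_def simsun_ended_word_def)
    next
      fix T assume T: "T \<subseteq> S - {m}"
      then have "card T < card S"
        using fin S by (intro psubset_card_mono) auto
      then show "(\<Sum>u\<in>permutations_of_set T. simsun_ended_weight t u) = andre_poly 1 t (card T)"
        using less.prems T by (intro less.hyps) (auto intro: finite_subset)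
    qed
    then show ?thesis
      using 3 by simp
  qed
qed

lemma sum_simsun_weight:
  assumes "finite S" "0 \<notin> S"
  shows "(\<Sum>w\<in>permutations_of_set S. simsun_weight t w) = andre_poly 1 t (Suc (card S))"
  using assms
proof (induction "card S" arbitrary: S rule: less_induct)
  case less
  note fin = less.prems(1)
  show ?case
  proof (cases "card S")
    case 0
    then show ?thesis
      using fin by (simp add: simsun_weight_def simsun_word_def)
  next
    case (Suc n)
    define m where "m = Min S"
    have m: "m \<in> S"
      using Suc fin by (auto simp: m_def intro!: Min_in)
    have m0: "0 < m"
      using m less.prems(2) by (metis gr0I)
    note split = min_split_of_permutations[OF fin, folded m_def]
    have "(\<Sum>w\<in>permutations_of_set S. simsun_weight t w) =
       (\<Sum>k\<le>n. of_nat (n choose k) *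
          ((if k = 0 then 1 else t) * andre_poly 1 t k * andre_poly 1 t (Suc (n - k))))"
    proof (rule sum_permutations_of_set_rec[OF fin Suc m, where \<alpha> = "simsun_ended_weight t"
          and \<beta> = "\<lambda>_. simsun_weight t"])
      fix u v assume "u @ m # v \<in> permutations_of_set S"
      note sp = split[OF this]
      show "simsun_weight t (u @ m # v) =
          (if length u = 0 then 1 else t) * simsun_ended_weight t u * simsun_weight t v"
        using desc_append_Cons[OF sp(1,2)] simsun_word_append_Cons[OF m0 sp(1,2)]
        by (simp add: simsun_ended_weight_def simsun_weight_def power_add mult_ac)
    next
      fix T assume "T \<subseteq> S - {m}"
      then show "(\<Sum>u\<in>permutations_of_set T. simsun_ended_weight t u) = andre_poly 1 t (card T)"
        using less.prems by (intro sum_simsun_ended_weight) (auto intro: finite_subset)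
    next
      fix T k assume T: "T \<subseteq> S - {m}" "card T + k = n"
      then have "(\<Sum>v\<in>permutations_of_set T. simsun_weight t v) = andre_poly 1 t (Suc (card T))"
        using less.prems Suc by (intro less.hyps) (auto intro: finite_subset)
      then show "(\<Sum>v\<in>permutations_of_set T. simsun_weight t v) = andre_poly 1 t (Suc (n - k))"
        using T by auto
    qed
    \<comment> \<open>The term \<open>k = 0\<close> is the leading summand of the recurrence for the
      next index.\<close>
    also have "\<dots> = andre_poly 1 t (Suc n) + (\<Sum>k = 1..n. of_nat (n choose k) *
          ((if k = 0 then 1 else t) * andre_poly 1 t k * andre_poly 1 t (Suc (n - k))))"
      unfolding atMost_atLeast0 by (subst sum.atLeast_Suc_atMost) auto
    also have "\<dots> = andre_poly 1 t (Suc (Suc n))"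
      by (auto intro!: sum.cong simp: Suc_diff_le mult_ac)
    finally show ?thesis
      using Suc by simp
  qed
qed

lemma rs_eq_andre_poly: "rs m x = andre_poly 1 x (Suc m)"
proof -
  have "simsun_permutations m = {w \<in> permutations_of_set {1..m}. simsun_word w}"
  proof (intro set_eqI)
    fix w
    show "w \<in> simsun_permutations m \<longleftrightarrow> w \<in> {w \<in> permutations_of_set {1..m}. simsun_word w}"
    proof (cases "w \<in> permutations_of_set {1..m}")
      case True
      then have w: "set w = {1..m}"
        by (rule permutations_of_setD)
      have "no_double_descent (filter (\<lambda>a. a \<le> k) w)"
        if *: "\<forall>k\<in>{1..m}. no_double_descent (filter (\<lambda>a. a \<le> k) w)" for k
      proof -
        \<comment> \<open>Thresholds outside \<open>{1..m}\<close> give the empty word or repeat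
          threshold \<open>m\<close>.\<close>
        consider "k = 0 \<or> m = 0" | "k \<in> {1..m}" | "k > m" "m \<in> {1..m}"
          by fastforce
        then show ?thesis
        proof cases
          case 1
          then have "filter (\<lambda>a. a \<le> k) w = []"
            using w by (auto simp: filter_empty_conv)
          then show ?thesis by simp
        next
          case 3
          then have "filter (\<lambda>a. a \<le> k) w = filter (\<lambda>a. a \<le> m) w"
            using w by (intro filter_cong) auto
          then show ?thesis using * 3 by simp
        qed (use * in auto)
      qed
      then show ?thesis
        using True unfolding simsun_permutations_def simsun_word_def no_double_descent_iff by auto
    qed (simp add: simsun_permutations_def)
  qed
  then have "rs m x = (\<Sum>w\<in>permutations_of_set {1..m}. simsun_weight x w)"
    by (simp add: rs_def des_eq_desc simsun_weight_def sum.inter_filter)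
  then show ?thesis
    by (simp add: sum_simsun_weight)
qed

section \<open>Odd descents and even ascents\<close>

text \<open>The conditional factors weigh the steps into and out of the minimal letter, at positions
  \<open>k\<close> and \<open>k + 1\<close>; each is \<open>1\<close> when the adjacent block is
  empty.\<close>

fun parity_poly :: "'a::comm_semiring_1 \<Rightarrow> 'a \<Rightarrow> 'a \<Rightarrow> 'a \<Rightarrow> nat \<Rightarrow> 'a" where
  "parity_poly p q r s 0 = 1"
| "parity_poly p q r s (Suc n) = (\<Sum>k\<le>n. of_nat (n choose k) *
     ((if k = 0 then 1 else if odd k then p else r) * (if k = n then 1 else if odd k then s else q) *
      parity_poly p q r s k *
      (if odd k then parity_poly p q r s (n - k) else parity_poly r s p q (n - k))))"

lemma sum_parity_weight:
  assumes "finite S"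
  shows "(\<Sum>w\<in>permutations_of_set S. parity_weight p q r s w) = parity_poly p q r s (card S)"
  using assms
proof (induction "card S" arbitrary: S p q r s rule: less_induct)
  case less
  note fin = less.prems
  show ?case
  proof (cases "card S")
    case 0
    then show ?thesis
      using fin by simp
  next
    case (Suc n)
    define m where "m = Min S"
    have m: "m \<in> S"
      using Suc fin by (auto simp: m_def intro!: Min_in)
    note split = min_split_of_permutations[OF fin, folded m_def]
    show ?thesis
      unfolding Suc parity_poly.simps
    proof (rule sum_permutations_of_set_rec[OF fin Suc m, where \<alpha> = "parity_weight p q r s"
          and \<beta> = "\<lambda>k v. if odd k then parity_weight p q r s v else parity_weight r s p q v"])
      fix u v assume "u @ m # v \<in> permutations_of_set S"
      note sp = split[OF this]
      have "length u = n \<longleftrightarrow> v = []"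
        using sp(3) Suc by auto
      then show "parity_weight p q r s (u @ m # v) =
         (if length u = 0 then 1 else if odd (length u) then p else r) *
         (if length u = n then 1 else if odd (length u) then s else q) * parity_weight p q r s u *
         (if odd (length u) then parity_weight p q r s v else parity_weight r s p q v)"
        using parity_weight_append_Cons[OF sp(1,2), of p q r s] by (simp add: mult_ac)
    next
      fix T assume T: "T \<subseteq> S - {m}"
      then have "card T < card S"
        using fin m by (intro psubset_card_mono) auto
      then show "(\<Sum>u\<in>permutations_of_set T. parity_weight p q r s u) = parity_poly p q r s (card T)"
        using less.prems T by (intro less.hyps) (auto intro: finite_subset)
    next
      fix T k assume T: "T \<subseteq> S - {m}" "card T + k = n"
      then have "card T < card S" "finite T"
        using Suc fin by (auto intro: finite_subset)
      then have "(\<Sum>v\<in>permutations_of_set T. parity_weight p q r s v) = parity_poly p q r s (n - k)"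
        "(\<Sum>v\<in>permutations_of_set T. parity_weight r s p q v) = parity_poly r s p q (n - k)"
        using T less.hyps by auto
      then show "(\<Sum>v\<in>permutations_of_set T. if odd k then parity_weight p q r s v
            else parity_weight r s p q v) =
          (if odd k then parity_poly p q r s (n - k) else parity_poly r s p q (n - k))"
        by simp
    qed
  qed
qed

lemma parity_weight_map_antimono:
  assumes "\<And>a b. a \<in> set w \<Longrightarrow> b \<in> set w \<Longrightarrow> a < b \<Longrightarrow> h b < h a" "distinct w"
  shows "parity_weight p q r s (map h w) = parity_weight q p s r w"
  using assms
proof (induction p q r s w rule: parity_weight.induct)
  case (1 p q r s a b w)
  have "a < b \<or> b < a"
    using 1(3) by auto
  then have "h a > h b \<longleftrightarrow> \<not> a > b"
    using 1(2)[of a b] 1(2)[of b a] by auto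
  then show ?case
    using 1 by simp
qed auto

text \<open>The involution replacing each letter \<open>a\<close> by \<open>Suc n - a\<close>
  exchanges ascents and descents at every position.\<close>

lemma parity_poly_complement: "parity_poly p q r s n = parity_poly q p s r n"
proof -
  define h where "h a = Suc n - a" for a
  have "parity_poly p q r s n = (\<Sum>w\<in>permutations_of_set {1..n}. parity_weight p q r s w)"
    by (simp add: sum_parity_weight)
  also have "\<dots> = (\<Sum>w\<in>permutations_of_set {1..n}. parity_weight q p s r w)"
  proof (rule sum.reindex_bij_witness[where i = "map h" and j = "map h"])
    fix w assume "w \<in> permutations_of_set {1..n}"
    then have w: "set w = {1..n}" "distinct w"
      by (auto simp: permutations_of_set_def)
    have hh: "h (h a) = a" if "a \<in> {1..n}" for a
      using that by (auto simp: h_def)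
    have im: "h ` {1..n} = {1..n}"
    proof
      show "h ` {1..n} \<subseteq> {1..n}"
        by (auto simp: h_def)
      then show "{1..n} \<subseteq> h ` {1..n}"
        by (metis hh image_eqI image_subset_iff subsetI)
    qed
    show "map h (map h w) = w" "map h (map h w) = w"
      using w(1) hh by (auto intro!: map_idI)
    have "inj_on h {1..n}"
      using hh by (metis inj_onI)
    then show "map h w \<in> permutations_of_set {1..n}" "map h w \<in> permutations_of_set {1..n}"
      using w im by (auto simp: permutations_of_set_def distinct_map)
    have "parity_weight q p s r (map h w) = parity_weight p q r s w"
      using w by (intro parity_weight_map_antimono) (auto simp: h_def)
    then show "parity_weight q p s r (map h w) = parity_weight p q r s w" .
  qed
  also have "\<dots> = parity_poly q p s r n"
    by (simp add: sum_parity_weight)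
  finally show ?thesis .
qed

section \<open>The two recurrences for \<open>A_hat\<close> and their sum\<close>

lemma A_hat_eq_parity_poly: "A_hat n x y = parity_poly x 1 1 y n"
proof -
  have "A_hat n x y = (\<Sum>w\<in>permutations_of_set {1..n}. parity_weight x 1 1 y w)"
    unfolding A_hat_def
    by (intro sum.cong refl) (simp add: parity_weight_eq permutations_of_setD)
  then show ?thesis
    by (simp add: sum_parity_weight)
qed

text \<open>A right block starting at an even position has weights \<open>1 y x 1\<close>;
  complementation gives \<open>y 1 1 x\<close>, which is \<open>A_hat\<close> with exchanged
  arguments.\<close>

lemma A_hat_rec_min:
  "A_hat (Suc n) x y = (\<Sum>k\<le>n. of_nat (n choose k) *
     ((if odd k then x else 1) * (if k < n \<and> odd k then y else 1) * A_hat k x y *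
      (if odd k then A_hat (n - k) x y else A_hat (n - k) y x)))"
  unfolding A_hat_eq_parity_poly parity_poly.simps parity_poly_complement[of 1 y x 1]
  by (intro sum.cong refl) auto

text \<open>The cut at the minimum is applied after complementation, which amounts to cutting the
  original words at their maximum.\<close>

lemma A_hat_rec_max:
  "A_hat (Suc n) x y = (\<Sum>k\<le>n. of_nat (n choose k) *
     ((if 0 < k \<and> even k then y else 1) * (if k < n \<and> even k then x else 1) * A_hat k x y *
      (if odd k then A_hat (n - k) x y else A_hat (n - k) y x)))"
proof -
  have "A_hat (Suc n) x y = parity_poly 1 x y 1 (Suc n)"
    unfolding A_hat_eq_parity_poly by (rule parity_poly_complement)
  then show ?thesis
    unfolding A_hat_eq_parity_poly parity_poly.simps parity_poly_complement[of 1 x y 1]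
    by (auto intro!: sum.cong elim!: trans)
qed

text \<open>Reflecting \<open>k\<close> to \<open>Suc n - k\<close> turns \<open>n choose k\<close>
  into \<open>n choose (k - 1)\<close>; adding both forms is Pascal's rule.\<close>

lemma sum_choose_symmetric:
  fixes g :: "nat \<Rightarrow> 'a::comm_semiring_1"
  assumes "\<And>k. k \<in> {1..n} \<Longrightarrow> g (Suc n - k) = g k"
  shows "2 * (\<Sum>k = 1..n. of_nat (n choose k) * g k) = (\<Sum>k = 1..n. of_nat (Suc n choose k) * g k)"
proof -
  have "(\<Sum>k = 1..n. of_nat (n choose k) * g k) =
      (\<Sum>k = 1..n. of_nat (n choose (Suc n - k)) * g (Suc n - k))"
    by (rule sum.reindex_bij_witness[where i = "\<lambda>k. Suc n - k" and j = "\<lambda>k. Suc n - k"]) auto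
  also have "\<dots> = (\<Sum>k = 1..n. of_nat (n choose (k - 1)) * g k)"
  proof (intro sum.cong refl)
    fix k assume k: "k \<in> {1..n}"
    then have "n choose (Suc n - k) = n choose (k - 1)"
      using binomial_symmetric[of "k - 1" n] by auto
    then show "of_nat (n choose (Suc n - k)) * g (Suc n - k) = of_nat (n choose (k - 1)) * g k"
      using assms[OF k] by simp
  qed
  finally have "2 * (\<Sum>k = 1..n. of_nat (n choose k) * g k) =
     (\<Sum>k = 1..n. of_nat (n choose k) * g k) + (\<Sum>k = 1..n. of_nat (n choose (k - 1)) * g k)"
    by (simp only: mult_2)
  also have "\<dots> = (\<Sum>k = 1..n. of_nat (Suc n choose k) * g k)"
    unfolding sum.distrib[symmetric]
  proof (intro sum.cong refl)
    fix k assume "k \<in> {1..n}"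
    then obtain j where "k = Suc j"
      by (cases k) auto
    then show "of_nat (n choose k) * g k + of_nat (n choose (k - 1)) * g k = of_nat (Suc n choose k) * g k"
      by (simp add: algebra_simps)
  qed
  finally show ?thesis .
qed

lemma A_hat_eq_andre_poly_char_0:
  fixes x y :: "'a::{idom,ring_char_0}"
  assumes "n \<ge> 1"
  shows "A_hat n x y = (if even n then 1 + x else 1) * andre_poly ((1 + x) * (1 + y)) (1 + x * y) n"
  using assms
proof (induction n arbitrary: x y rule: less_induct)
  case (less n)
  define P Q where "P = (1 + x) * (1 + y)" and "Q = 1 + x * y"
  define K where "K = andre_poly P Q"
  \<comment> \<open>\<open>P\<close> and \<open>Q\<close> are symmetric in \<open>x\<close> and
    \<open>y\<close>, so exchanging the arguments affects only the factor for even
    \<open>k\<close>.\<close>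
  have A: "A_hat k x y = (if k = 0 then 1 else (if even k then 1 + x else 1) * K k)"
    "A_hat k y x = (if k = 0 then 1 else (if even k then 1 + y else 1) * K k)" if "k < n" for k
    using less.IH[of k x y] less.IH[of k y x] that
    by (auto simp: A_hat_def K_def P_def Q_def mult.commute des1_def asc0_def descents_short ascents_short)
  consider "n = 1" | N where "n = Suc (Suc N)"
    using less.prems by (metis One_nat_def not0_implies_Suc not_one_le_zero)
  then show ?case
  proof cases
    case 1
    then show ?thesis
      by (simp add: A_hat_eq_parity_poly)
  next
    case (2 N)
    \<comment> \<open>\<open>e\<close> is the prefactor claimed for \<open>n\<close>,
      \<open>c\<close> the leading coefficient of the Andre recurrence, and \<open>e * T k\<close>
      the sum of the \<open>k\<close>-th terms of both recurrences without their binomial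
      coefficient.\<close>
    define e where "e = (if even N then 1 + x else 1)"
    define c where "c = (if even N then 1 else P)"
    define T where "T k = (if k = 0 \<or> k = Suc N then c * K (Suc N) else
      (if even k \<and> odd N then P else 1) * Q * (K k * K (Suc N - k)))" for k
    have "2 * A_hat n x y = A_hat (Suc (Suc N)) x y + A_hat (Suc (Suc N)) x y"
      using 2 by simp
    also have "\<dots> = (\<Sum>k\<le>Suc N. of_nat (Suc N choose k) *
     ((if odd k then x else 1) * (if k < Suc N \<and> odd k then y else 1) * A_hat k x y *
      (if odd k then A_hat (Suc N - k) x y else A_hat (Suc N - k) y x)) +
       of_nat (Suc N choose k) *
     ((if 0 < k \<and> even k then y else 1) * (if k < Suc N \<and> even k then x else 1) * A_hat k x y *
      (if odd k then A_hat (Suc N - k) x y else A_hat (Suc N - k) y x)))"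
      unfolding sum.distrib by (rule arg_cong2[where f = "(+)", OF A_hat_rec_min A_hat_rec_max])
    also have "\<dots> = (\<Sum>k\<le>Suc N. of_nat (Suc N choose k) * (e * T k))"
    proof (intro sum.cong refl)
      fix k assume "k \<in> {..Suc N}"
      then have k: "k \<le> Suc N" by simp
      then have lt: "k < n" "Suc N - k < n"
        using 2 by auto
      have par: "even (Suc N - k) \<longleftrightarrow> (even k \<longleftrightarrow> odd N)"
        using k by auto
      have "(if odd k then x else 1) * (if k < Suc N \<and> odd k then y else 1) * A_hat k x y *
         (if odd k then A_hat (Suc N - k) x y else A_hat (Suc N - k) y x) +
        (if 0 < k \<and> even k then y else 1) * (if k < Suc N \<and> even k then x else 1) * A_hat k x y *
         (if odd k then A_hat (Suc N - k) x y else A_hat (Suc N - k) y x) = e * T k"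
      proof -
        consider "k = 0" | "k = Suc N" | "0 < k" "k < Suc N"
          using k by linarith
        then show ?thesis
        proof cases
          case 1
          then show ?thesis
            using lt by (auto simp: A e_def c_def T_def P_def algebra_simps)
        next
          case 2
          then show ?thesis
            using lt by (auto simp: A e_def c_def T_def P_def algebra_simps)
        next
          case 3
          then have "k \<noteq> 0" "Suc N - k \<noteq> 0" "k \<noteq> Suc N"
            by auto
          then show ?thesis
            using lt 3 par unfolding A[OF lt(1)] A[OF lt(2)] e_def T_def P_def Q_def
            by (cases "even k"; cases "even N") (simp_all add: algebra_simps)
        qed
      qed
      then show "of_nat (Suc N choose k) *
       ((if odd k then x else 1) * (if k < Suc N \<and> odd k then y else 1) * A_hat k x y *
         (if odd k then A_hat (Suc N - k) x y else A_hat (Suc N - k) y x)) +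
       of_nat (Suc N choose k) *
       ((if 0 < k \<and> even k then y else 1) * (if k < Suc N \<and> even k then x else 1) * A_hat k x y *
         (if odd k then A_hat (Suc N - k) x y else A_hat (Suc N - k) y x)) =
       of_nat (Suc N choose k) * (e * T k)"
        by (simp only: distrib_left[symmetric])
    qed
    also have "\<dots> = e * (\<Sum>k\<le>Suc N. of_nat (Suc N choose k) * T k)"
      by (simp only: sum_distrib_left mult.left_commute)
    also have "(\<Sum>k\<le>Suc N. of_nat (Suc N choose k) * T k) =
        T (Suc N) + T 0 + (\<Sum>k = 1..N. of_nat (Suc N choose k) * T k)"
      unfolding atMost_atLeast0
      by (subst sum.atLeast_Suc_atMost) (simp_all add: add_ac)
    \<comment> \<open>The two boundary terms agree and \<open>T\<close> is symmetric, so the whole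
      sum is twice the Andre recurrence.\<close>
    also have "(\<Sum>k = 1..N. of_nat (Suc N choose k) * T k) = 2 * (\<Sum>k = 1..N. of_nat (N choose k) * T k)"
      by (rule sum_choose_symmetric[symmetric]) (auto simp: T_def mult_ac)
    also have "(\<Sum>k = 1..N. of_nat (N choose k) * T k) =
       (\<Sum>k = 1..N. of_nat (N choose k) * ((if even k \<and> odd N then P else 1) * Q * (K k * K (Suc N - k))))"
      by (intro sum.cong refl) (simp add: T_def)
    also have "e * (T (Suc N) + T 0 + 2 * \<dots>) = 2 * (e * K n)"
      by (simp add: T_def K_def c_def 2 algebra_simps del: of_nat_mult)
    finally have "2 * A_hat n x y = 2 * (e * K n)" .
    then have "A_hat n x y = e * K n"
      by simp
    then show ?thesis
      using 2 by (simp add: e_def K_def P_def Q_def)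
  qed
qed

section \<open>Transport to arbitrary commutative rings\<close>

text \<open>Unital ring morphisms commute with \<open>A_hat\<close> and \<open>andre_poly\<close>,
  as both are polynomial expressions in their arguments.\<close>

locale ring_morphism =
  fixes h :: "'a::comm_ring_1 \<Rightarrow> 'b::comm_ring_1"
  assumes add: "h (a + b) = h a + h b"
    and mult: "h (a * b) = h a * h b"
    and one: "h 1 = 1"
begin

lemma zero: "h 0 = 0"
  using add[of 0 0] by simp

lemma sum: "h (\<Sum>i\<in>I. f i) = (\<Sum>i\<in>I. h (f i))"
  by (induction I rule: infinite_finite_induct) (simp_all add: add zero)

lemma power: "h (a ^ n) = h a ^ n"
  by (induction n) (simp_all add: mult one)

lemma of_nat: "h (of_nat n) = of_nat n"
  by (induction n) (simp_all add: add zero one)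

lemmas hom_simps = add mult one zero sum power of_nat

lemma A_hat: "h (A_hat n x y) = A_hat n (h x) (h y)"
  by (simp add: A_hat_def hom_simps)

lemma andre_poly: "h (andre_poly P Q n) = andre_poly (h P) (h Q) n"
proof (induction P Q n rule: andre_poly.induct)
  case (3 P Q n)
  then show ?case
    by (auto simp: hom_simps intro!: arg_cong2[where f = "(+)"] sum.cong)
qed (simp_all add: hom_simps)

text \<open>Iterating this extension from the integers yields evaluation of bivariate integer
  polynomials.\<close>

lemma poly_eval: "ring_morphism (\<lambda>p. poly (map_poly h p) y)"
proof
  show add': "poly (map_poly h (p + q)) y = poly (map_poly h p) y + poly (map_poly h q) y" for p q
    by (induction p q rule: poly_induct2) (simp_all add: map_poly_pCons hom_simps algebra_simps)
  have smult: "poly (map_poly h (smult a q)) y = h a * poly (map_poly h q) y" for a q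
    by (induction q) (simp_all add: map_poly_pCons hom_simps algebra_simps)
  show "poly (map_poly h (p * q)) y = poly (map_poly h p) y * poly (map_poly h q) y" for p q
    by (induction p) (simp_all add: map_poly_pCons hom_simps add' smult algebra_simps)
  show "poly (map_poly h 1) y = 1"
    by (simp add: one_pCons map_poly_pCons hom_simps)
qed

end

lemma A_hat_eq_andre_poly:
  fixes x y :: "'a::comm_ring_1"
  assumes "n \<ge> 1"
  shows "A_hat n x y = (if even n then 1 + x else 1) * andre_poly ((1 + x) * (1 + y)) (1 + x * y) n"
proof -
  interpret of_int: ring_morphism "of_int :: int \<Rightarrow> 'a"
    by standard simp_all
  interpret inner: ring_morphism "\<lambda>p :: int poly. poly (map_poly of_int p) x"
    by (rule of_int.poly_eval)
  define h where "h p = poly (map_poly (\<lambda>p. poly (map_poly of_int p) x) p) y" for p :: "int poly poly"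
  interpret outer: ring_morphism h
    unfolding h_def by (rule inner.poly_eval)
  \<comment> \<open>\<open>X\<close> is the inner indeterminate as a constant polynomial,
    \<open>Y\<close> the outer one; \<open>int poly poly\<close> is an integral domain of
    characteristic 0.\<close>
  define X Y :: "int poly poly" where "X = [:[:0, 1:]:]" and "Y = [:0, 1:]"
  have h: "h X = x" "h Y = y"
    by (simp_all add: h_def X_def Y_def map_poly_pCons one_pCons)
  have "h (A_hat n X Y) =
      h ((if even n then 1 + X else 1) * andre_poly ((1 + X) * (1 + Y)) (1 + X * Y) n)"
    using A_hat_eq_andre_poly_char_0[OF assms, of X Y] by simp
  then show ?thesis
    by (simp add: outer.A_hat outer.andre_poly outer.hom_simps h split: if_splits)
qed

section \<open>From Andre polynomials to the numbers \<open>d_bar\<close>\<close>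

lemma finite_andre_permutations: "finite (andre_permutations n)"
  by (rule finite_subset[of _ "permutations_of_set {1..n}"]) (auto simp: andre_permutations_def)

lemma des_andre_permutation:
  assumes "w \<in> andre_permutations n" "n \<ge> 1"
  shows "des w \<le> (n - 1) div 2" "length w = n"
proof -
  have w: "w \<in> permutations_of_set {1..n}" "andre_word w"
    using assms by (auto simp: andre_permutations_eq)
  then show len: "length w = n"
    by (simp add: length_finite_permutations_of_set)
  have "set w = {1..n}"
    using w(1) by (rule permutations_of_setD)
  then have "2 * desc w < length w"
    using w(2) assms(2) by (intro desc_less_of_andre_word) auto
  then show "des w \<le> (n - 1) div 2"
    using len by (simp add: des_eq_desc)
qed

lemma sum_andre_permutations:
  assumes "n \<ge> 1"
  shows "(\<Sum>w\<in>andre_permutations n. P ^ (n div 2 - des w) * Q ^ des w) =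
    (if even n then P else 1) * andre_poly P Q n"
proof -
  have "(\<Sum>w\<in>andre_permutations n. P ^ (n div 2 - des w) * Q ^ des w) =
      (\<Sum>w\<in>andre_permutations n. (if even n then P else 1) * andre_weight P Q w)"
  proof (intro sum.cong refl)
    fix w assume w: "w \<in> andre_permutations n"
    \<comment> \<open>For even \<open>n\<close> this restores the factor \<open>P\<close> omitted
      from \<open>andre_weight\<close>.\<close>
    have "n div 2 = (if even n then 1 else 0) + (n - 1) div 2"
      using assms by (cases n) (auto elim!: oddE)
    then have "n div 2 - des w = (if even n then 1 else 0) + ((n - 1) div 2 - des w)"
      using des_andre_permutation(1)[OF w assms] by simp
    then show "P ^ (n div 2 - des w) * Q ^ des w = (if even n then P else 1) * andre_weight P Q w"
      using w des_andre_permutation(2)[OF w assms]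
      by (simp add: andre_weight_def andre_permutations_eq power_add mult.assoc flip: des_eq_desc)
  qed
  also have "\<dots> = (if even n then P else 1) * (\<Sum>w\<in>permutations_of_set {1..n}. andre_weight P Q w)"
    unfolding sum_distrib_left[symmetric] andre_permutations_eq
    by (intro arg_cong2[where f = "(*)"] refl sum.mono_neutral_left) (auto simp: andre_weight_def)
  finally show ?thesis
    using assms by (simp add: sum_andre_weight)
qed

text \<open>Grouping by descents shows that \<open>d_bar n i\<close> counts Andre permutations with
  \<open>i\<close> marked descents; then the sums are exchanged.\<close>

lemma sum_d_bar:
  fixes g :: "nat \<Rightarrow> 'a::comm_semiring_1"
  assumes "n \<ge> 1"
  shows "(\<Sum>i = 0..n div 2. of_nat (d_bar n i) * g i) =
    (\<Sum>w\<in>andre_permutations n. \<Sum>i = 0..n div 2. of_nat (des w choose i) * g i)"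
proof -
  have le: "des w \<le> n div 2" if "w \<in> andre_permutations n" for w
    using des_andre_permutation(1)[OF that assms] by (rule order_trans) (simp add: div_le_mono)
  have "d_bar n i = (\<Sum>w\<in>andre_permutations n. des w choose i)" for i
  proof -
    \<comment> \<open>Binomial coefficients vanish for \<open>j < i\<close>, so the range may start
      at \<open>0\<close>.\<close>
    have "d_bar n i = (\<Sum>j = 0..n div 2. (j choose i) * d n j)"
      unfolding d_bar_def by (rule sum.mono_neutral_left) (auto simp: not_le)
    also have "\<dots> = (\<Sum>j = 0..n div 2. \<Sum>w\<in>{w \<in> andre_permutations n. des w = j}. des w choose i)"
      by (simp add: d_def mult.commute)
    also have "\<dots> = (\<Sum>w\<in>andre_permutations n. des w choose i)"
      using le finite_andre_permutations by (intro sum.group) auto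
    finally show ?thesis .
  qed
  then have "(\<Sum>i = 0..n div 2. of_nat (d_bar n i) * g i) =
      (\<Sum>i = 0..n div 2. \<Sum>w\<in>andre_permutations n. of_nat (des w choose i) * g i)"
    by (simp add: sum_distrib_right)
  then show ?thesis
    by (subst sum.swap)
qed

text \<open>Terms beyond \<open>j\<close> vanish, and the rest is the binomial theorem times
  \<open>P ^ (m - j)\<close>.\<close>

lemma binomial_homogeneous:
  fixes P s :: "'a::comm_ring_1"
  assumes "j \<le> m"
  shows "(\<Sum>i = 0..m. of_nat (j choose i) * (s ^ i * P ^ (m - i))) = P ^ (m - j) * (P + s) ^ j"
proof -
  have "(\<Sum>i = 0..m. of_nat (j choose i) * (s ^ i * P ^ (m - i))) =
      (\<Sum>i\<le>j. of_nat (j choose i) * (s ^ i * P ^ (m - i)))"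
    using assms by (intro sum.mono_neutral_right ballI subsetI) (simp_all add: not_le binomial_eq_0)
  also have "\<dots> = (\<Sum>i\<le>j. P ^ (m - j) * (of_nat (j choose i) * s ^ i * P ^ (j - i)))"
  proof (intro sum.cong refl)
    fix i assume "i \<in> {..j}"
    then have "m - i = (m - j) + (j - i)"
      using assms by simp
    then show "of_nat (j choose i) * (s ^ i * P ^ (m - i)) =
        P ^ (m - j) * (of_nat (j choose i) * s ^ i * P ^ (j - i))"
      by (simp add: power_add mult_ac)
  qed
  also have "\<dots> = P ^ (m - j) * (s + P) ^ j"
    by (simp add: binomial_ring sum_distrib_left)
  finally show ?thesis
    by (simp add: add.commute)
qed

text \<open>Common source of both claims: each Andre permutation contributes a binomial expansion
  with \<open>j = des w\<close> and \<open>m = n div 2\<close>.\<close>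

lemma sum_d_bar_homogeneous:
  fixes P s :: "'a::comm_ring_1"
  assumes "n \<ge> 1"
  shows "(\<Sum>i = 0..n div 2. of_nat (d_bar n i) * (s ^ i * P ^ (n div 2 - i))) =
    (if even n then P else 1) * andre_poly P (P + s) n"
proof -
  have le: "des w \<le> n div 2" if "w \<in> andre_permutations n" for w
    using des_andre_permutation(1)[OF that assms] by (rule order_trans) (simp add: div_le_mono)
  show ?thesis
    unfolding sum_d_bar[OF assms] sum_andre_permutations[OF assms, symmetric]
    using le by (intro sum.cong refl binomial_homogeneous)
qed

theorem theorem2p9:
  fixes n :: nat and x y :: "'a::comm_ring_1"
  assumes "n \<ge> 1"
  shows "A_bar n x y =
           (\<Sum>i = 0..n div 2. (- 1) ^ i * of_nat (d_bar n i) * (x + y) ^ i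
              * (1 + x + y + x * y) ^ (n div 2 - i))
       \<and> rs (n - 1) (1 + x) = (\<Sum>i = 0..n div 2. of_nat (d_bar n i) * x ^ i)"
proof
  define P where "P = (1 + x) * (1 + y)"
  have P: "1 + x + y + x * y = P" "P + - (x + y) = 1 + x * y"
    by (simp_all add: P_def algebra_simps)
  \<comment> \<open>For even \<open>n\<close> the factor \<open>1 + y\<close> of
    \<open>A_bar\<close> completes \<open>1 + x\<close> to \<open>P\<close>.\<close>
  have "A_bar n x y = (if even n then P else 1) * andre_poly P (P + - (x + y)) n"
    unfolding P(2) using A_hat_eq_andre_poly[OF assms, of x y]
    by (simp add: A_bar_def P_def mult_ac)
  also have "\<dots> = (\<Sum>i = 0..n div 2. of_nat (d_bar n i) * ((- (x + y)) ^ i * P ^ (n div 2 - i)))"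
    by (rule sum_d_bar_homogeneous[OF assms, symmetric])
  also have "\<dots> = (\<Sum>i = 0..n div 2. (- 1) ^ i * of_nat (d_bar n i) * (x + y) ^ i
              * (1 + x + y + x * y) ^ (n div 2 - i))"
    unfolding P(1) power_minus[of "x + y"] by (intro sum.cong refl) (simp only: mult_ac)
  finally show "A_bar n x y = (\<Sum>i = 0..n div 2. (- 1) ^ i * of_nat (d_bar n i) * (x + y) ^ i
              * (1 + x + y + x * y) ^ (n div 2 - i))" .
  \<comment> \<open>Specialization to \<open>P = 1\<close> and \<open>s = x\<close>.\<close>
  show "rs (n - 1) (1 + x) = (\<Sum>i = 0..n div 2. of_nat (d_bar n i) * x ^ i)"
    using sum_d_bar_homogeneous[OF assms, of x 1] assms by (simp add: rs_eq_andre_poly)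
qed

end
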